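(* Let $\mathsf C\subset\mathsf H$ be a code with error radius $\ell$ with respect to error operators $\{E_\mu\}_{\mu=1}^N$, let $\mathcal L_E$ be the error Lindbladian (with arbitrary error operators $E_\mu$ and weights $\lambda_\mu$), $\Delta>0$ the noise rate, and let $\mathcal L_R$ be a recovery Lindbladian satisfying the following three conditions. First (convergence), with parameters $\kappa>0$ and $0<\chi<\infty$: for every $\rho\in\mathsf N$, $\rho(t)=e^{\mathcal L_Rt}(\rho)$ has a limit $\rho_\infty$ as $t\to\infty$ (depending in general on $\rho$), and $\|\rho(t)-\rho_\infty\|_1\le\chi e^{-\kappa t}$ for all $\rho\in\mathsf N$, $t>0$. Second (recovery), with $\mathcal R=\lim_{t\to\infty}e^{\mathcal L_Rt}$: for all $\rho_0\in\mathsf N_0$ and $|\boldsymbol\mu|,|\boldsymbol\nu|\le\ell$, $\mathcal R(K_{\boldsymbol\mu}\rho_0K_{\boldsymbol\nu}^\dagger)\propto\rho_0$ (in particular $\mathcal R(\rho_0)=\rho_0$). Third (strict error reduction): for all $t\ge0$ and all error sequences $\boldsymbol\mu,\boldsymbol\nu$ there are coefficients $a_{\boldsymbol\mu\boldsymbol\nu,\boldsymbol\mu'\boldsymbol\nu'}(t)$ such that for all $\rho_0\in\mathsf N_0$, $e^{\mathcal L_Rt}(K_{\boldsymbol\mu}\rho_0K_{\boldsymbol\nu}^\dagger)=\sum_{\boldsymbol\mu',\boldsymbol\nu'}a_{\boldsymbol\mu\boldsymbol\nu,\boldsymbol\mu'\boldsymbol\nu'}(t)K_{\boldsymbol\mu'}\rho_0K_{\boldsymbol\nu'}^\dagger$,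 where $a_{\boldsymbol\mu\boldsymbol\nu,\boldsymbol\mu'\boldsymbol\nu'}(t)=0$ if $|\boldsymbol\mu'|>|\boldsymbol\mu|$ or $|\boldsymbol\nu'|>|\boldsymbol\nu|$. Let $\mathcal L=\mathcal L_R+\Delta\mathcal L_E$ and let $\epsilon(t),\delta(t)$ be the logical error measures defined in the context. Then for all $t\ge 0$, both $X=\epsilon(t)$ and $X=\delta(t)$ satisfy $$X\;\le\;\frac{1}{\chi+1}\left(\frac{(\chi+1)\Delta\|\mathcal L_E\|_{1\to1,\mathsf E}}{\kappa}\right)^{\ell+1}F_\ell(\kappa t)\;\le\;\frac{1}{\chi+1}\left(\frac{(\chi+1)\Delta\|\mathcal L_E\|_{1\to1,\mathsf E}}{\kappa}\right)^{\ell+1}\kappa t\;=\;\frac{1}{\chi+1}\,\eta^{\ell+1}\kappa t,$$ where $\eta:=(\chi+1)\Delta\|\mathcal L_E\|_{1\to1,\mathsf E}/\kappa$ and $F_\ell(z)=z\,g(\ell,z)-\ell\,g(\ell+1,z)\le z$, with $g(a,z)=\frac{1}{\Gamma(a)}\int_0^z x^{a-1}e^{-x}\,dx$ the regularized lower incomplete Gamma function (with the limiting convention $g(0,z)=1$).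
   Context: Setting. $\mathsf H$ is a Hilbert space of dimension $D$; $\mathsf C\subset\mathsf H$ is a $q$-dimensional subspace (the codespace, $q\ge2$) with orthogonal projector $P$. $\|A\|_1=\mathrm{Tr}\sqrt{A^\dagger A}$. $\mathsf N$ is the set of density operators on $\mathsf H$ (positive semidefinite, unit trace); $\mathsf N_0\subset\mathsf N$ is the set of density operators supported on $\mathsf C$. Noise. $\mathcal L_E(\rho)=\sum_{\mu=1}^N\lambda_\mu\big(E_\mu\rho E_\mu^\dagger-\tfrac12\{E_\mu^\dagger E_\mu,\rho\}\big)$ with $\lambda_\mu>0$, $\sum_\mu\lambda_\mu=N$. Elementary errors are the operators in $\{E_1,\dots,E_N,E_1^\dagger E_1,\dots,E_N^\dagger E_N\}$. For a finite sequence $\boldsymbol\mu=(\mu_1,\dots,\mu_k)$ of labels of elementary errors, $K_{\boldsymbol\mu}=K_{\mu_1}\cdots K_{\mu_k}$, with weight $|\boldsymbol\mu|=k$; the empty sequence has weight $0$ and $K_\emptyset=I$. Error radius. $\ell$ is the largest integer such that the Knill–Laflamme condition $PK_{\boldsymbol\mu}^\dagger K_{\boldsymbol\nu}P=C_{\boldsymbol\mu\boldsymbol\nu}P$ (with scalars $C_{\boldsymbol\mu\boldsymbol\nu}$) holds for all $|\boldsymbol\mu|,|\boldsymbol\nu|\le\ell$. Correctable error space. $\mathsf E\subset\mathsf H$ is the span of all vectors $K_{\boldsymbol\mu}|w\rangle$ with $|w\rangle\in\mathsf C$, $|\boldsymbol\mu|\le\ell$. For a superoperator $\mathcal M$, $\|\mathcal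 M\|_{1\to1,\mathsf E}=\max_{O}\|\mathcal M(O)\|_1/\|O\|_1$, the maximum being over nonzero operators $O$ on $\mathsf H$ with range and support in $\mathsf E$. Recovery. $\mathcal L_R$ is a Lindbladian (generator of a CPTP semigroup) on $\mathsf H$, and $\mathcal R=\lim_{t\to\infty}e^{\mathcal L_Rt}$. Logical error measures. $\epsilon(t)=1-\min_{|\psi_0\rangle\in\mathsf C}\mathrm{Tr}\big(|\psi_0\rangle\langle\psi_0|\,\mathcal R e^{\mathcal Lt}(|\psi_0\rangle\langle\psi_0|)\big)$ (min over unit vectors), and $\delta(t)=1-\min\tfrac12\big\|e^{\mathcal Lt}(|\psi_0\rangle\langle\psi_0|)-e^{\mathcal Lt}(|\psi_1\rangle\langle\psi_1|)\big\|_1$, min over pairs of orthogonal unit vectors $|\psi_0\rangle,|\psi_1\rangle\in\mathsf C$. *)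

theory Defs
  imports "HOL-Analysis.Analysis"
begin

text \<open>
  The \<open>D\<close>-dimensional Hilbert space is \<open>complex ^ 'n\<close> with \<open>D = CARD('n)\<close>; its norm is the library
  norm, and its complex subspaces are the sets satisfying \<open>vec.subspace\<close>.
\<close>

type_synonym 'n operator = "complex ^ 'n ^ 'n"
type_synonym 'n superoperator = "'n operator \<Rightarrow> 'n operator"

text \<open>The Hermitian inner product, antilinear in the first argument
  (the library's \<open>\<bullet>\<close> on this type is its real part).\<close>

definition cinner :: "complex ^ 'n \<Rightarrow> complex ^ 'n \<Rightarrow> complex" where
  "cinner u v = (\<Sum>i\<in>UNIV. cnj (u $ i) * v $ i)"

definition cscale :: "complex \<Rightarrow> 'n::finite operator \<Rightarrow> 'n::finite operator"  (infixr \<open>\<cdot>\<^sub>C\<close> 75) where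
  "c \<cdot>\<^sub>C A = (\<chi> i j. c * A $ i $ j)"

definition dagger :: "'n::finite operator \<Rightarrow> 'n::finite operator" where
  "dagger A = (\<chi> i j. cnj (A $ j $ i))"

definition ketbra :: "complex ^ 'n \<Rightarrow> 'n::finite operator" where
  "ketbra v = (\<chi> i j. v $ i * cnj (v $ j))"

text \<open>Over the complex numbers a nonnegative quadratic form forces the operator to be Hermitian.\<close>

definition psd :: "'n::finite operator \<Rightarrow> bool" where
  "psd A \<longleftrightarrow> (\<forall>v. cinner v (A *v v) \<in> \<real>\<^sub>\<ge>\<^sub>0)"

text \<open>Meaningful for positive semidefinite arguments, which have a unique positive semidefinite root.\<close>

definition psd_sqrt :: "'n::finite operator \<Rightarrow> 'n::finite operator" where
  "psd_sqrt A = (THE B. psd B \<and> B ** B = A)"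

definition trace_norm :: "'n::finite operator \<Rightarrow> real" where
  "trace_norm A = Re (trace (psd_sqrt (dagger A ** A)))"

definition op_range :: "'n::finite operator \<Rightarrow> (complex ^ 'n) set" where
  "op_range A = range (\<lambda>v. A *v v)"

text \<open>The orthogonal complement of the kernel.\<close>

definition op_support :: "'n::finite operator \<Rightarrow> (complex ^ 'n) set" where
  "op_support A = {v. \<forall>u. A *v u = 0 \<longrightarrow> cinner u v = 0}"

definition orthogonal_projector :: "(complex ^ 'n) set \<Rightarrow> 'n::finite operator \<Rightarrow> bool" where
  "orthogonal_projector S P \<longleftrightarrow> P ** P = P \<and> dagger P = P \<and> op_range P = S"

definition density_ops :: "'n::finite operator set" where
  "density_ops = {\<rho>. psd \<rho> \<and> trace \<rho> = 1}"

definition code_density_ops :: "(complex ^ 'n) set \<Rightarrow> 'n::finite operator set" where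
  "code_density_ops C = {\<rho> \<in> density_ops. op_support \<rho> \<subseteq> C}"

definition clinear_superop :: "'n::finite superoperator \<Rightarrow> bool" where
  "clinear_superop M \<longleftrightarrow>
     (\<forall>A B. M (A + B) = M A + M B) \<and> (\<forall>c A. M (c \<cdot>\<^sub>C A) = c \<cdot>\<^sub>C M A)"

text \<open>\<open>\<Phi> \<otimes> id\<^sub>k\<close> preserves positivity for every \<open>k\<close>. An operator on the space tensored with
  \<open>\<complex>\<^sup>k\<close> is a \<open>k \<times> k\<close> block matrix \<open>X i j\<close> (with \<open>i, j < k\<close>), and \<open>\<Phi> \<otimes> id\<^sub>k\<close> acts blockwise.\<close>

definition block_psd :: "nat \<Rightarrow> (nat \<Rightarrow> nat \<Rightarrow> 'n::finite operator) \<Rightarrow> bool" where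
  "block_psd k X \<longleftrightarrow>
     (\<forall>v :: nat \<Rightarrow> complex ^ 'n. (\<Sum>i<k. \<Sum>j<k. cinner (v i) (X i j *v v j)) \<in> \<real>\<^sub>\<ge>\<^sub>0)"

definition completely_positive :: "'n::finite superoperator \<Rightarrow> bool" where
  "completely_positive \<Phi> \<longleftrightarrow>
     (\<forall>k X. block_psd k X \<longrightarrow> block_psd k (\<lambda>i j. \<Phi> (X i j)))"

definition cptp :: "'n::finite superoperator \<Rightarrow> bool" where
  "cptp \<Phi> \<longleftrightarrow> clinear_superop \<Phi> \<and> completely_positive \<Phi> \<and> (\<forall>X. trace (\<Phi> X) = trace X)"

text \<open>The exponential \<open>e\<^bsup>Mt\<^esup>\<close>, given by its power series.\<close>

definition superop_exp :: "'n::finite superoperator \<Rightarrow> real \<Rightarrow> 'n::finite superoperator" where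
  "superop_exp M t X = (\<Sum>k. (t ^ k / fact k) *\<^sub>R (M ^^ k) X)"

definition lindbladian :: "'n::finite superoperator \<Rightarrow> bool" where
  "lindbladian M \<longleftrightarrow> clinear_superop M \<and> (\<forall>t\<ge>0. cptp (superop_exp M t))"

text \<open>The pointwise limit of \<open>e\<^bsup>Mt\<^esup>\<close> as \<open>t\<close> tends to infinity; meaningful when it exists.\<close>

definition superop_limit :: "'n::finite superoperator \<Rightarrow> 'n::finite superoperator" where
  "superop_limit M X = Lim at_top (\<lambda>t. superop_exp M t X)"

text \<open>The induced \<open>1 \<rightarrow> 1\<close> norm over operators with range and support in \<open>S\<close>. For a linear
  superoperator and \<open>S\<close> a nonzero subspace the supremum is attained.\<close>

definition restricted_norm :: "(complex ^ 'n) set \<Rightarrow> 'n::finite superoperator \<Rightarrow> real" where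
  "restricted_norm S M =
     (SUP X\<in>{X. X \<noteq> 0 \<and> op_range X \<subseteq> S \<and> op_support X \<subseteq> S}. trace_norm (M X) / trace_norm X)"

definition error_lindbladian ::
    "nat \<Rightarrow> (nat \<Rightarrow> real) \<Rightarrow> (nat \<Rightarrow> 'n::finite operator) \<Rightarrow> 'n::finite superoperator" where
  "error_lindbladian N lam E \<rho> =
     (\<Sum>\<mu>=1..N. lam \<mu> *\<^sub>R (E \<mu> ** \<rho> ** dagger (E \<mu>)
        - (1/2) *\<^sub>R (dagger (E \<mu>) ** E \<mu> ** \<rho> + \<rho> ** (dagger (E \<mu>) ** E \<mu>))))"

text \<open>Labels of elementary errors: \<open>Jump \<mu>\<close> stands for \<open>E\<^sub>\<mu>\<close>, \<open>Decay \<mu>\<close> for \<open>E\<^sub>\<mu>\<^sup>\<dagger> E\<^sub>\<mu>\<close>.\<close>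

datatype error_label = Jump nat | Decay nat

fun elementary_error :: "(nat \<Rightarrow> 'n::finite operator) \<Rightarrow> error_label \<Rightarrow> 'n::finite operator" where
  "elementary_error E (Jump \<mu>) = E \<mu>"
| "elementary_error E (Decay \<mu>) = dagger (E \<mu>) ** E \<mu>"

definition error_seqs :: "nat \<Rightarrow> error_label list set" where
  "error_seqs N = lists (Jump ` {1..N} \<union> Decay ` {1..N})"

text \<open>The weight of a sequence is its \<^const>\<open>length\<close>.\<close>

definition error_seqs_upto :: "nat \<Rightarrow> nat \<Rightarrow> error_label list set" where
  "error_seqs_upto N m = {\<mu> \<in> error_seqs N. length \<mu> \<le> m}"

fun error_product :: "(nat \<Rightarrow> 'n::finite operator) \<Rightarrow> error_label list \<Rightarrow> 'n::finite operator" where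
  "error_product E [] = mat 1"
| "error_product E (x # xs) = elementary_error E x ** error_product E xs"

definition knill_laflamme :: "nat \<Rightarrow> (nat \<Rightarrow> 'n::finite operator) \<Rightarrow> 'n::finite operator \<Rightarrow> nat \<Rightarrow> bool" where
  "knill_laflamme N E P m \<longleftrightarrow>
     (\<forall>\<mu>\<in>error_seqs_upto N m. \<forall>\<nu>\<in>error_seqs_upto N m.
        \<exists>c. P ** dagger (error_product E \<mu>) ** error_product E \<nu> ** P = c \<cdot>\<^sub>C P)"

definition has_error_radius :: "nat \<Rightarrow> (nat \<Rightarrow> 'n::finite operator) \<Rightarrow> 'n::finite operator \<Rightarrow> nat \<Rightarrow> bool" where
  "has_error_radius N E P l \<longleftrightarrow>
     knill_laflamme N E P l \<and> (\<forall>m. knill_laflamme N E P m \<longrightarrow> m \<le> l)"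

definition correctable_space ::
    "nat \<Rightarrow> (nat \<Rightarrow> 'n::finite operator) \<Rightarrow> (complex ^ 'n) set \<Rightarrow> nat \<Rightarrow> (complex ^ 'n) set" where
  "correctable_space N E C l =
     vec.span {error_product E \<mu> *v w | \<mu> w. \<mu> \<in> error_seqs_upto N l \<and> w \<in> C}"

definition convergence_condition :: "'n::finite superoperator \<Rightarrow> real \<Rightarrow> real \<Rightarrow> bool" where
  "convergence_condition LR \<kappa> chi \<longleftrightarrow>
     (\<forall>\<rho>\<in>density_ops. \<exists>\<sigma>. ((\<lambda>t. superop_exp LR t \<rho>) \<longlongrightarrow> \<sigma>) at_top \<and>
        (\<forall>t>0. trace_norm (superop_exp LR t \<rho> - \<sigma>) \<le> chi * exp (- \<kappa> * t)))"

definition recovery_condition ::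
    "'n::finite superoperator \<Rightarrow> nat \<Rightarrow> (nat \<Rightarrow> 'n::finite operator) \<Rightarrow> (complex ^ 'n) set \<Rightarrow> nat \<Rightarrow> bool" where
  "recovery_condition LR N E C l \<longleftrightarrow>
     (\<forall>\<rho>0\<in>code_density_ops C. \<forall>\<mu>\<in>error_seqs_upto N l. \<forall>\<nu>\<in>error_seqs_upto N l.
        \<exists>c. superop_limit LR (error_product E \<mu> ** \<rho>0 ** dagger (error_product E \<nu>)) = c \<cdot>\<^sub>C \<rho>0)"

text \<open>The coefficients may depend on \<open>t\<close>, \<open>\<mu>\<close>, \<open>\<nu>\<close> but not on the code state. Since they vanish
  when \<open>\<mu>'\<close> is longer than \<open>\<mu>\<close> or \<open>\<nu>'\<close> is longer than \<open>\<nu>\<close>, the sum over all pairs of sequences is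
  a finite sum over the remaining pairs.\<close>

definition strict_error_reduction ::
    "'n::finite superoperator \<Rightarrow> nat \<Rightarrow> (nat \<Rightarrow> 'n::finite operator) \<Rightarrow> (complex ^ 'n) set \<Rightarrow> bool" where
  "strict_error_reduction LR N E C \<longleftrightarrow>
     (\<forall>t\<ge>0. \<forall>\<mu>\<in>error_seqs N. \<forall>\<nu>\<in>error_seqs N.
        \<exists>a :: error_label list \<Rightarrow> error_label list \<Rightarrow> complex. \<forall>\<rho>0\<in>code_density_ops C.
          superop_exp LR t (error_product E \<mu> ** \<rho>0 ** dagger (error_product E \<nu>)) =
          (\<Sum>\<mu>'\<in>error_seqs_upto N (length \<mu>). \<Sum>\<nu>'\<in>error_seqs_upto N (length \<nu>).
             a \<mu>' \<nu>' \<cdot>\<^sub>C (error_product E \<mu>' ** \<rho>0 ** dagger (error_product E \<nu>'))))"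

text \<open>Both infima are minima: the sets of code states are compact, and nonempty when \<open>dim C \<ge> 2\<close>.
  The trace is real here; \<^const>\<open>Re\<close> only changes the type.\<close>

definition logical_infidelity ::
    "(complex ^ 'n) set \<Rightarrow> 'n::finite superoperator \<Rightarrow> 'n::finite superoperator \<Rightarrow> real \<Rightarrow> real" where
  "logical_infidelity C LR L t =
     1 - (INF \<psi>0\<in>{\<psi>0 \<in> C. norm \<psi>0 = 1}.
            Re (trace (ketbra \<psi>0 ** superop_limit LR (superop_exp L t (ketbra \<psi>0)))))"

definition logical_indistinguishability ::
    "(complex ^ 'n) set \<Rightarrow> 'n::finite superoperator \<Rightarrow> real \<Rightarrow> real" where
  "logical_indistinguishability C L t =
     1 - (INF (\<psi>0, \<psi>1)\<in>{(\<psi>0, \<psi>1). \<psi>0 \<in> C \<and> \<psi>1 \<in> C \<and> norm \<psi>0 = 1 \<and> norm \<psi>1 = 1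
                                  \<and> cinner \<psi>0 \<psi>1 = 0}.
            1/2 * trace_norm (superop_exp L t (ketbra \<psi>0) - superop_exp L t (ketbra \<psi>1)))"

definition reg_lower_gamma :: "real \<Rightarrow> real \<Rightarrow> real" where
  "reg_lower_gamma a z =
     (if a = 0 then 1 else 1 / Gamma a * integral {0..z} (\<lambda>x. x powr (a - 1) * exp (- x)))"

definition F_fun :: "nat \<Rightarrow> real \<Rightarrow> real" where
  "F_fun l z = z * reg_lower_gamma (real l) z - real l * reg_lower_gamma (real l + 1) z"

end

theory Submission
  imports Defs
begin

text \<open>
  Expand \<open>e\<^bsup>Lt\<^esup>\<close> in powers of the noise (Dyson series), with \<open>L\<^sub>R\<close> as the free generator, up to order
  \<open>l\<close> and with exact remainder. By strict error reduction the term of order \<open>k\<close> is a combination of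
  operators \<open>K\<^sub>\<mu> \<rho> K\<^sub>\<nu>\<^sup>\<dagger>\<close> with \<open>\<mu>\<close> and \<open>\<nu>\<close> of weight at most \<open>k\<close>; it is traceless for \<open>k > 0\<close>, so
  the recovery map annihilates it for \<open>0 < k \<le> l\<close> and \<open>e\<^bsup>L\<^sub>Rt\<^esup>\<close> damps it at rate \<open>\<kappa>\<close>.
  Inductively its trace norm is at most \<open>(\<chi> \<Delta> \<parallel>L\<^sub>E\<parallel> / \<kappa>)\<^sup>k g(k, \<kappa>t)\<close>. Only the remainder
  survives the recovery, and it is estimated using that \<open>e\<^bsup>Lt\<^esup>\<close> contracts the trace norm of Hermitian
  operators; \<open>F\<^sub>l\<close> is the antiderivative of \<open>g(l, \<cdot>)\<close>.
\<close>

section \<open>Hermitian inner product and operators\<close>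

text \<open>The generator is a sum, and contraction of the combined semigroup has to be derived from
  its two summands. This is done through dissipativity, a condition on generators that is additive
  and is checked for \<open>LR\<close> and for the Lindblad form separately; no product formula for
  the exponential of a sum is involved.

  Trace norm estimates are made for Hermitian operators, where the spectral theorem supplies a sign
  operator and the norm becomes a maximum of linear functionals. Sums, integrals and derivatives are
  then handled through one fixed functional, and every Dyson term and the remainder are kept
  Hermitian.

  The order \<open>l\<close> is where ranges force a stop: the next noise factor still acts on an
  operator with range in the correctable space, so the restricted norm pays for it, but its result
  may leave that space. Damping is thus used \<open>l\<close> times and contributes
  \<open>chi ^ l\<close>, which is enlarged to \<open>(chi + 1) ^ l\<close> to meet the stated
  constant. The functions g(k, .) arise as Erlang distributions: each damped order convolves the
  bound with one more exponential waiting time of rate \<kappa>.\<close>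

lemma cinner_add_right: "cinner u (v + w) = cinner u v + cinner u w"
  by (simp add: cinner_def algebra_simps sum.distrib)

lemma cinner_add_left: "cinner (u + v) w = cinner u w + cinner v w"
  by (simp add: cinner_def algebra_simps sum.distrib)

lemma cinner_diff_right: "cinner u (v - w) = cinner u v - cinner u w"
  by (simp add: cinner_def algebra_simps sum_subtractf)

lemma cinner_scale_right: "cinner u (c *s v) = c * cinner u v"
  by (simp add: cinner_def sum_distrib_left mult_ac)

lemma cinner_scale_left: "cinner (c *s u) v = cnj c * cinner u v"
  by (simp add: cinner_def sum_distrib_left mult_ac)

lemma cinner_zero [simp]: "cinner u 0 = 0" "cinner 0 u = 0"
  by (simp_all add: cinner_def)

lemma cinner_sum_right: "cinner u (\<Sum>i\<in>I. f i) = (\<Sum>i\<in>I. cinner u (f i))"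
  by (induction I rule: infinite_finite_induct) (simp_all add: cinner_add_right)

lemma cnj_cinner: "cnj (cinner u v) = cinner v u"
  by (simp add: cinner_def mult.commute)

lemma Re_cinner: "Re (cinner u v) = u \<bullet> v"
  by (simp add: cinner_def inner_vec_def inner_complex_def)

lemma cinner_self: "cinner v v = complex_of_real ((norm v)\<^sup>2)"
proof -
  have "Im (cinner v v) = 0"
    using cnj_cinner[of v v] by (simp add: complex_eq_iff)
  then show ?thesis
    by (simp add: complex_eq_iff Re_cinner power2_norm_eq_inner)
qed

lemma cinner_self_unit: "norm v = 1 \<Longrightarrow> cinner v v = 1"
  by (simp add: cinner_self)

lemma scale_of_real: "complex_of_real r *s v = r *\<^sub>R v"
  by (simp add: vec_eq_iff complex_eq_iff)

lemma norm_vector_scale: "norm (c *s v) = cmod c * norm v" for v :: "complex ^ 'n"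
proof -
  have "complex_of_real ((norm (c *s v))\<^sup>2) = cnj c * (c * complex_of_real ((norm v)\<^sup>2))"
    by (simp only: cinner_self[symmetric] cinner_scale_left cinner_scale_right mult.left_commute)
  also have "\<dots> = complex_of_real ((cmod c * norm v)\<^sup>2)"
    unfolding power_mult_distrib of_real_mult complex_norm_square by (simp add: mult_ac)
  finally have "(norm (c *s v))\<^sup>2 = (cmod c * norm v)\<^sup>2"
    by (metis of_real_eq_iff)
  then show ?thesis
    by (simp add: power2_eq_iff_nonneg)
qed

lemma matrix_scale_vector: "A *v (c *s v) = c *s (A *v v)" for A :: "complex ^ 'n ^ 'm"
  by (simp add: vec_eq_iff matrix_vector_mult_def sum_distrib_left mult_ac)

lemma cscale_vector: "(c \<cdot>\<^sub>C A) *v v = c *s (A *v v)"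
  by (simp add: vec_eq_iff cscale_def matrix_vector_mult_def sum_distrib_left mult_ac)

lemma cscale_of_real: "complex_of_real r \<cdot>\<^sub>C A = r *\<^sub>R A"
  by (simp add: vec_eq_iff cscale_def complex_eq_iff)

lemma cscale_simps:
  "c \<cdot>\<^sub>C (A + B) = c \<cdot>\<^sub>C A + c \<cdot>\<^sub>C B" "(c + d) \<cdot>\<^sub>C A = c \<cdot>\<^sub>C A + d \<cdot>\<^sub>C A"
  "c \<cdot>\<^sub>C d \<cdot>\<^sub>C A = (c * d) \<cdot>\<^sub>C A" "1 \<cdot>\<^sub>C A = A" "0 \<cdot>\<^sub>C A = 0" "c \<cdot>\<^sub>C (0 :: 'n::finite operator) = 0"
  by (simp_all add: vec_eq_iff cscale_def algebra_simps)

lemma cscale_mult: "(c \<cdot>\<^sub>C A) ** B = c \<cdot>\<^sub>C (A ** B)" "A ** (c \<cdot>\<^sub>C B) = c \<cdot>\<^sub>C (A ** B)"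
  by (simp_all add: vec_eq_iff cscale_def matrix_matrix_mult_def sum_distrib_left mult_ac)

lemma trace_cscale: "trace (c \<cdot>\<^sub>C A) = c * trace A"
  by (simp add: trace_def cscale_def sum_distrib_left)

lemma linear_cscale: "linear (\<lambda>A. c \<cdot>\<^sub>C A)"
  by (rule linearI) (simp_all add: vec_eq_iff cscale_def algebra_simps)

lemma trace_scaleR: "trace (r *\<^sub>R A) = r *\<^sub>R trace A" for A :: "'n::finite operator"
  by (simp add: trace_def scaleR_sum_right)

lemma linear_trace: "linear (trace :: 'n::finite operator \<Rightarrow> complex)"
  by (rule linearI) (simp_all add: trace_add trace_scaleR)

lemma matrix_mult_scaleR:
  "(r *\<^sub>R A) ** B = r *\<^sub>R (A ** B)" "A ** (r *\<^sub>R B) = r *\<^sub>R (A ** B)"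
  for A B :: "'n::finite operator"
  by (simp_all add: vec_eq_iff matrix_matrix_mult_def scaleR_sum_right)

lemma matrix_mult_diff:
  "A ** (B - C) = A ** B - A ** C" "(A - B) ** C = A ** C - B ** C"
  for A B C :: "'n::finite operator"
  by (simp_all add: vec_eq_iff matrix_matrix_mult_def algebra_simps sum_subtractf)

lemma matrix_add_rdistrib: "(A + B) ** C = A ** C + B ** C" for A B C :: "'n::finite operator"
  by (simp add: vec_eq_iff matrix_matrix_mult_def algebra_simps sum.distrib)

lemma linear_Re_trace: "linear (\<lambda>X. Re (trace (A ** X)))" for A :: "'n::finite operator"
  by (rule linearI) (simp_all add: matrix_add_ldistrib matrix_mult_scaleR trace_add trace_scaleR)

lemma linear_vector_action: "linear (\<lambda>A. A *v v)" for v :: "complex ^ 'n::finite"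
  by (rule linearI) (simp_all add: vec_eq_iff matrix_vector_mult_def algebra_simps sum.distrib scaleR_sum_right)

lemma scaleR_vector: "(r *\<^sub>R A) *v v = r *\<^sub>R (A *v v)" for A :: "'n::finite operator"
  using linear_vector_action linear_scale by blast

lemma sum_vector: "(\<Sum>i\<in>I. f i) *v v = (\<Sum>i\<in>I. f i *v v)" for f :: "_ \<Rightarrow> 'n::finite operator"
  using linear_sum[OF linear_vector_action] by blast

lemma cinner_dagger: "cinner u (A *v v) = cinner (dagger A *v u) v"
proof -
  have "cinner u (A *v v) = (\<Sum>i\<in>UNIV. \<Sum>j\<in>UNIV. cnj (u $ i) * (A $ i $ j * v $ j))"
    by (simp add: cinner_def matrix_vector_mult_def sum_distrib_left)
  also have "\<dots> = (\<Sum>j\<in>UNIV. \<Sum>i\<in>UNIV. cnj (u $ i) * (A $ i $ j * v $ j))"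
    by (rule sum.swap)
  also have "\<dots> = cinner (dagger A *v u) v"
    by (simp add: cinner_def matrix_vector_mult_def dagger_def sum_distrib_left mult_ac)
  finally show ?thesis .
qed

lemma dagger_simps [simp]:
  "dagger (dagger A) = A" "dagger (A + B) = dagger A + dagger B"
  "dagger (A - B) = dagger A - dagger B" "dagger (r *\<^sub>R A) = r *\<^sub>R dagger A"
  "dagger (A ** B) = dagger B ** dagger A" "dagger (0 :: 'n::finite operator) = 0"
  "dagger (c \<cdot>\<^sub>C A) = cnj c \<cdot>\<^sub>C dagger A" "dagger (mat 1 :: 'n operator) = mat 1"
  by (simp_all add: vec_eq_iff dagger_def matrix_matrix_mult_def cscale_def mult.commute mat_def)

lemma linear_dagger: "linear (dagger :: 'n::finite operator \<Rightarrow> 'n operator)"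
  by (rule linearI) simp_all

lemma trace_dagger: "trace (dagger A) = cnj (trace A)"
  by (simp add: trace_def dagger_def)

abbreviation hermitian :: "'n::finite operator \<Rightarrow> bool" where
  "hermitian A \<equiv> dagger A = A"

lemma subspace_hermitian: "subspace {A :: 'n::finite operator. hermitian A}"
  by (auto simp: subspace_def)

lemma hermitian_sum: "(\<And>i. i \<in> I \<Longrightarrow> hermitian (f i)) \<Longrightarrow> hermitian (\<Sum>i\<in>I. f i)"
  using subspace_sum[OF subspace_hermitian, of I f] by simp

lemma hermitian_form_real: "hermitian A \<Longrightarrow> cinner v (A *v v) = complex_of_real (Re (cinner v (A *v v)))"
  by (metis cinner_dagger cnj_cinner complex_is_Real_iff Reals_cnj_iff of_real_Re)

lemma hermitian_trace_real: "hermitian A \<Longrightarrow> trace A = complex_of_real (Re (trace A))"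
  by (metis trace_dagger Reals_cnj_iff of_real_Re)

text \<open>Complex polarisation: the form at \<open>u + v\<close> and at
  \<open>u + \<i> *s v\<close> yields the sum and the difference of \<open>cinner u (A *v v)\<close>
  and \<open>cinner v (A *v u)\<close>, so both vanish. Over the reals a rotation by a right angle
  would be a counterexample.\<close>

lemma eq_zero_if_form_zero:
  assumes "\<And>v. cinner v (A *v v) = 0"
  shows "A = 0"
proof -
  have "cinner u (A *v v) = 0" for u v
  proof -
    have "cinner (u + v) (A *v (u + v)) = cinner u (A *v v) + cinner v (A *v u)"
      by (simp add: assms matrix_vector_right_distrib cinner_add_left cinner_add_right)
    then have 1: "cinner u (A *v v) + cinner v (A *v u) = 0"
      by (simp add: assms)
    have "cinner (u + \<i> *s v) (A *v (u + \<i> *s v)) = \<i> * cinner u (A *v v) - \<i> * cinner v (A *v u)"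
      by (simp add: assms matrix_vector_right_distrib cinner_add_left cinner_add_right
          matrix_scale_vector cinner_scale_left cinner_scale_right)
    then have "\<i> * (cinner u (A *v v) - cinner v (A *v u)) = 0"
      by (simp add: assms right_diff_distrib)
    with 1 show ?thesis
      by simp
  qed
  then have "A *v v = 0" for v
    using cinner_self[of "A *v v"] by simp
  then show ?thesis
    by (metis matrix_eq matrix_vector_mult_0)
qed

section \<open>Positive semidefinite and rank-one operators\<close>

lemma psdD: "psd A \<Longrightarrow> 0 \<le> Re (cinner v (A *v v))"
  by (auto simp: psd_def complex_nonneg_Reals_iff)

lemma psd_hermitian: "psd A \<Longrightarrow> hermitian A"
proof -
  assume A: "psd A"
  have "cinner v ((dagger A - A) *v v) = 0" for v
  proof -
    have "cinner v (dagger A *v v) = cnj (cinner v (A *v v))"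
      by (metis cinner_dagger cnj_cinner)
    also have "\<dots> = cinner v (A *v v)"
      using A unfolding psd_def by (metis Reals_cnj_iff nonneg_Reals_subset_Reals subsetD)
    finally show ?thesis
      by (simp add: matrix_vector_mult_diff_rdistrib cinner_diff_right)
  qed
  then show ?thesis
    using eq_zero_if_form_zero by (metis right_minus_eq)
qed

lemma psd_iff: "psd A \<longleftrightarrow> hermitian A \<and> (\<forall>v. 0 \<le> Re (cinner v (A *v v)))"
proof
  assume "hermitian A \<and> (\<forall>v. 0 \<le> Re (cinner v (A *v v)))"
  then show "psd A"
    unfolding psd_def by (metis hermitian_form_real nonneg_Reals_of_real_iff)
qed (simp add: psd_hermitian psdD)

lemma psd_0: "psd 0"
  by (simp add: psd_def)

lemma psd_add: "psd A \<Longrightarrow> psd B \<Longrightarrow> psd (A + B)"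
  by (simp add: psd_iff matrix_vector_mult_add_rdistrib cinner_add_right)

lemma psd_scaleR: "psd A \<Longrightarrow> 0 \<le> r \<Longrightarrow> psd (r *\<^sub>R A)"
  by (simp add: psd_iff scaleR_vector scale_of_real[symmetric] cinner_scale_right)

lemma psd_sum: "(\<And>i. i \<in> I \<Longrightarrow> psd (f i)) \<Longrightarrow> psd (\<Sum>i\<in>I. f i)"
  by (induction I rule: infinite_finite_induct) (simp_all add: psd_0 psd_add)

lemma psd_sandwich: "psd A \<Longrightarrow> psd (B ** A ** dagger B)"
  unfolding psd_def by (simp add: matrix_vector_mul_assoc[symmetric] cinner_dagger[of _ B])

lemma psd_gram: "psd (dagger A ** A)"
  unfolding psd_def
  by (simp add: matrix_vector_mul_assoc[symmetric] cinner_dagger[of _ "dagger A"] cinner_self)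

lemma ketbra_vector: "ketbra v *v u = cinner v u *s v"
  by (simp add: vec_eq_iff ketbra_def matrix_vector_mult_def cinner_def sum_distrib_left
      sum_distrib_right mult_ac)

lemma hermitian_ketbra: "hermitian (ketbra v)"
  by (simp add: vec_eq_iff dagger_def ketbra_def mult.commute)

lemma trace_ketbra_mult: "trace (ketbra v ** Z) = cinner v (Z *v v)"
proof -
  have "trace (ketbra v ** Z) = (\<Sum>i\<in>UNIV. \<Sum>k\<in>UNIV. v $ i * cnj (v $ k) * Z $ k $ i)"
    by (simp add: trace_def matrix_matrix_mult_def ketbra_def)
  also have "\<dots> = (\<Sum>k\<in>UNIV. \<Sum>i\<in>UNIV. v $ i * cnj (v $ k) * Z $ k $ i)"
    by (rule sum.swap)
  also have "\<dots> = cinner v (Z *v v)"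
    by (simp add: cinner_def matrix_vector_mult_def sum_distrib_left mult_ac)
  finally show ?thesis .
qed

lemma trace_ketbra: "trace (ketbra v) = complex_of_real ((norm v)\<^sup>2)"
  using trace_ketbra_mult[of v "mat 1"] by (simp add: cinner_self)

lemma ketbra_form: "cinner u (ketbra v *v u) = complex_of_real ((cmod (cinner v u))\<^sup>2)"
proof -
  have "cinner u (ketbra v *v u) = cinner v u * cnj (cinner v u)"
    by (simp only: ketbra_vector cinner_scale_right cnj_cinner)
  then show ?thesis
    by (simp only: complex_norm_square)
qed

lemma psd_ketbra: "psd (ketbra v)"
  by (simp add: psd_def ketbra_form)

lemma trace_mult_sum: "trace ((\<Sum>i\<in>I. f i) ** Z) = (\<Sum>i\<in>I. trace (f i ** Z))"
  for Z :: "'n::finite operator"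
proof -
  have "linear (\<lambda>X. trace (X ** Z))"
    by (rule linearI) (simp_all add: matrix_add_rdistrib matrix_mult_scaleR trace_add trace_scaleR)
  then show ?thesis
    by (rule linear_sum)
qed

section \<open>Spectral decomposition\<close>

definition orthonormal :: "(complex ^ 'n::finite) set \<Rightarrow> bool" where
  "orthonormal S \<longleftrightarrow> finite S \<and> (\<forall>u\<in>S. \<forall>v\<in>S. cinner u v = (if u = v then 1 else 0))"

text \<open>The eigenvalues are a function on the eigenvectors, so functional calculus (square root,
  absolute value, sign, positive part) changes \<open>c\<close> and keeps \<open>S\<close>.\<close>

definition spectral_sum :: "(complex ^ 'n::finite) set \<Rightarrow> (complex ^ 'n \<Rightarrow> real) \<Rightarrow> 'n operator" where
  "spectral_sum S c = (\<Sum>v\<in>S. c v *\<^sub>R ketbra v)"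

lemma spectral_sum_vector: "spectral_sum S c *v u = (\<Sum>v\<in>S. (c v * cinner v u) *s v)"
proof -
  have "spectral_sum S c *v u = (\<Sum>v\<in>S. c v *\<^sub>R (cinner v u *s v))"
    by (simp add: spectral_sum_def sum_vector scaleR_vector ketbra_vector)
  also have "\<dots> = (\<Sum>v\<in>S. (c v * cinner v u) *s v)"
    by (rule sum.cong) (simp_all add: scale_of_real[symmetric] vec_eq_iff)
  finally show ?thesis .
qed

lemma spectral_sum_eigenvector:
  assumes "orthonormal S" "w \<in> S"
  shows "spectral_sum S c *v w = c w *\<^sub>R w"
proof -
  have "spectral_sum S c *v w = (\<Sum>v\<in>S. if v = w then complex_of_real (c w) *s w else 0)"
    unfolding spectral_sum_vector
    by (rule sum.cong) (use assms in \<open>auto simp: orthonormal_def\<close>)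
  also have "\<dots> = complex_of_real (c w) *s w"
    using assms by (simp add: orthonormal_def)
  finally show ?thesis
    by (simp add: scale_of_real)
qed

lemma spectral_sum_mult:
  assumes "orthonormal S"
  shows "spectral_sum S c ** spectral_sum S d = spectral_sum S (\<lambda>v. c v * d v)"
proof -
  have "spectral_sum S c *v (spectral_sum S d *v u) = spectral_sum S (\<lambda>v. c v * d v) *v u" for u
  proof -
    have "spectral_sum S c *v (spectral_sum S d *v u) =
        (\<Sum>v\<in>S. spectral_sum S c *v ((d v * cinner v u) *s v))"
      unfolding spectral_sum_vector[of S d] by (rule linear_sum) (rule matrix_vector_mul_linear)
    also have "\<dots> = (\<Sum>v\<in>S. (d v * cinner v u) *s (c v *\<^sub>R v))"
      by (rule sum.cong) (simp_all add: matrix_scale_vector spectral_sum_eigenvector[OF assms])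
    also have "\<dots> = spectral_sum S (\<lambda>v. c v * d v) *v u"
      unfolding spectral_sum_vector
      by (rule sum.cong) (simp_all add: vec_eq_iff scale_of_real[symmetric] mult_ac)
    finally show ?thesis .
  qed
  then show ?thesis
    by (simp add: matrix_eq matrix_vector_mul_assoc)
qed

lemma spectral_sum_linear:
  "spectral_sum S c - spectral_sum S d = spectral_sum S (\<lambda>v. c v - d v)"
  "spectral_sum S c + spectral_sum S d = spectral_sum S (\<lambda>v. c v + d v)"
  by (simp_all add: spectral_sum_def sum_subtractf sum.distrib algebra_simps)

lemma hermitian_spectral_sum: "hermitian (spectral_sum S c)"
  unfolding spectral_sum_def by (rule hermitian_sum) (simp add: hermitian_ketbra)

lemma psd_spectral_sum: "(\<And>v. v \<in> S \<Longrightarrow> 0 \<le> c v) \<Longrightarrow> psd (spectral_sum S c)"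
  unfolding spectral_sum_def by (intro psd_sum psd_scaleR psd_ketbra)

lemma trace_spectral_sum_mult:
  "Re (trace (spectral_sum S c ** Z)) = (\<Sum>v\<in>S. c v * Re (cinner v (Z *v v)))"
  by (simp add: spectral_sum_def trace_mult_sum matrix_mult_scaleR trace_scaleR trace_ketbra_mult)

lemma norm_orthonormal: "orthonormal S \<Longrightarrow> v \<in> S \<Longrightarrow> norm v = 1"
  using cinner_self[of v] unfolding orthonormal_def
  by (metis norm_ge_zero of_real_eq_1_iff power2_eq_1_iff neg_0_le_iff_le not_one_le_zero)

lemma trace_spectral_sum:
  assumes "orthonormal S"
  shows "Re (trace (spectral_sum S c)) = (\<Sum>v\<in>S. c v)"
  using trace_spectral_sum_mult[of S c "mat 1"] norm_orthonormal[OF assms] by (simp add: cinner_self)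

text \<open>With \<open>w = A *v v\<close>, the form at \<open>w - r *\<^sub>R v\<close> equals
  \<open>b - 2 * r * (norm w)\<^sup>2\<close>, since the term quadratic in \<open>r\<close>
  vanishes. An affine function of \<open>r\<close> that is never negative has slope zero.\<close>

lemma psd_form_zero:
  assumes "psd A" "cinner v (A *v v) = 0"
  shows "A *v v = 0"
proof -
  define w where "w = A *v v"
  have wv: "cinner v (A *v w) = cinner w w"
    unfolding w_def by (metis assms(1) cinner_dagger psd_hermitian)
  define b where "b = Re (cinner w (A *v w))"
  have *: "0 \<le> b - 2 * r * (norm w)\<^sup>2" for r :: real
  proof -
    have "cinner (w - r *\<^sub>R v) (A *v (w - r *\<^sub>R v)) =
        cinner w (A *v w) - r * cinner w w - r * cinner w w"
    proof -
      have "w - r *\<^sub>R v = w + complex_of_real (- r) *s v"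
        by (simp only: scale_of_real) simp
      then show ?thesis
        by (simp only: matrix_vector_right_distrib cinner_add_left cinner_add_right
          matrix_scale_vector cinner_scale_left cinner_scale_right wv assms(2))
         (simp add: w_def)
    qed
    then show ?thesis
      using psdD[OF assms(1), of "w - r *\<^sub>R v"] by (simp add: cinner_self b_def)
  qed
  have "norm w = 0"
  proof (rule ccontr)
    assume "norm w \<noteq> 0"
    then have "0 < (norm w)\<^sup>2"
      by simp
    then have "2 * ((b + 1) / (norm w)\<^sup>2) * (norm w)\<^sup>2 = 2 * (b + 1)"
      by simp
    with *[of "(b + 1) / (norm w)\<^sup>2"] *[of 0] show False
      by simp
  qed
  then show ?thesis
    by (simp add: w_def)
qed

text \<open>A maximiser of the quadratic form on the unit sphere is an eigenvector.\<close>

lemma hermitian_eigenvector_pos: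
  assumes A: "hermitian A" and u: "0 < Re (cinner u (A *v u))"
  obtains w d where "norm w = 1" "d \<noteq> 0" "A *v w = d *\<^sub>R w"
proof -
  define f where "f v = v \<bullet> (A *v v)" for v
  have f: "f v = Re (cinner v (A *v v))" for v
    by (simp add: f_def Re_cinner)
  have f_scale: "f (r *\<^sub>R v) = r\<^sup>2 * f v" for r v
    by (simp add: f scale_of_real[symmetric] matrix_scale_vector cinner_scale_right cinner_scale_left
        power2_eq_square)
  have "u \<noteq> 0"
    using u by auto
  have "continuous_on (sphere 0 1) f"
    unfolding f_def by (intro continuous_intros linear_continuous_on matrix_vector_mul_bounded_linear)
  moreover have "sgn u \<in> sphere 0 1"
    using \<open>u \<noteq> 0\<close> by (simp add: norm_sgn)
  ultimately obtain w where w: "w \<in> sphere 0 1" and max: "\<And>v. v \<in> sphere 0 1 \<Longrightarrow> f v \<le> f w"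
    using continuous_attains_sup[of "sphere 0 1" f] by auto
  define d where "d = f w"
  have "f u = (norm u)\<^sup>2 * f (sgn u)"
    using f_scale[of "norm u" "sgn u"] by (simp add: sgn_div_norm \<open>u \<noteq> 0\<close>)
  then have "0 < f (sgn u)"
    using u by (simp add: f zero_less_mult_iff)
  then have "0 < d"
    using max[OF \<open>sgn u \<in> sphere 0 1\<close>] by (simp add: d_def)
  have bound: "f v \<le> d * (norm v)\<^sup>2" for v
  proof (cases "v = 0")
    case False
    then have "f v = (norm v)\<^sup>2 * f (sgn v)"
      using f_scale[of "norm v" "sgn v"] by (simp add: sgn_div_norm)
    also have "\<dots> \<le> (norm v)\<^sup>2 * d"
      using max[of "sgn v"] False by (intro mult_left_mono) (simp_all add: d_def norm_sgn)
    finally show ?thesis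
      by (simp add: mult.commute)
  qed (simp add: f_def)
  have Q: "(d *\<^sub>R mat 1 - A) *v v = d *\<^sub>R v - A *v v" for v
    by (simp add: matrix_vector_mult_diff_rdistrib scaleR_vector)
  have Qf: "Re (cinner v ((d *\<^sub>R mat 1 - A) *v v)) = d * (norm v)\<^sup>2 - f v" for v
    unfolding Q by (simp add: f_def Re_cinner inner_diff_right power2_norm_eq_inner)
  \<comment> \<open>\<open>d\<close> bounds the form of \<open>A\<close> on the unit sphere and is
    attained at \<open>w\<close>, so the form of this positive operator vanishes at
    \<open>w\<close>; \<open>psd_form_zero\<close> turns that into the eigenvalue equation without
    differentiating.\<close>
  have "psd (d *\<^sub>R mat 1 - A)"
    using A bound by (simp add: psd_iff Qf)
  moreover have "cinner w ((d *\<^sub>R mat 1 - A) *v w) = 0"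
  proof -
    have "Re (cinner w ((d *\<^sub>R mat 1 - A) *v w)) = 0"
      unfolding Qf using w by (simp add: d_def)
    then show ?thesis
      using hermitian_form_real[of "d *\<^sub>R mat 1 - A" w] A by simp
  qed
  ultimately have "A *v w = d *\<^sub>R w"
    using psd_form_zero Q by fastforce
  with w \<open>0 < d\<close> show thesis
    by (intro that[of w d]) simp_all
qed

text \<open>By polarisation some value of the form is nonzero; if it is negative, \<open>- A\<close>
  is maximised instead. Both uses rely on \<open>d \<noteq> 0\<close>: it makes \<open>w\<close>
  orthogonal to the kernel, and it keeps \<open>A *v w\<close> nonzero.\<close>

lemma hermitian_eigenvector:
  assumes A: "hermitian A" and "A \<noteq> 0"
  obtains w d where "norm w = 1" "d \<noteq> 0" "A *v w = d *\<^sub>R w"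
proof -
  obtain u where u: "cinner u (A *v u) \<noteq> 0"
    using eq_zero_if_form_zero \<open>A \<noteq> 0\<close> by blast
  then have "Re (cinner u (A *v u)) \<noteq> 0"
    using hermitian_form_real[OF A, of u] by auto
  then consider "0 < Re (cinner u (A *v u))" | "Re (cinner u (A *v u)) < 0"
    by linarith
  then show thesis
  proof cases
    case 1
    then show ?thesis
      using hermitian_eigenvector_pos[OF A] that by blast
  next
    case 2
    have neg: "(- A) *v v = - (A *v v)" for v
      using matrix_vector_mult_diff_rdistrib[of 0 A v] by simp
    have "0 < Re (cinner u ((- A) *v u))"
      using 2 by (simp add: neg Re_cinner)
    moreover have "hermitian (- A)"
      using A dagger_simps(3)[of 0 A] by simp
    ultimately obtain w d where "norm w = 1" "d \<noteq> 0" "(- A) *v w = d *\<^sub>R w"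
      using hermitian_eigenvector_pos by blast
    then show ?thesis
      using that[of w "- d"] by (simp add: neg) (metis add.inverse_inverse)
  qed
qed

text \<open>The bound serves only to guarantee an orthonormal family of greatest size, so the real
  dimension is good enough.\<close>

lemma orthonormal_card_le: "orthonormal S \<Longrightarrow> card S \<le> DIM(complex ^ 'n)"
  for S :: "(complex ^ 'n::finite) set"
proof -
  assume S: "orthonormal S"
  have "pairwise orthogonal S"
    using S by (auto simp: pairwise_def orthogonal_def Re_cinner[symmetric] orthonormal_def)
  moreover have "0 \<notin> S"
    using norm_orthonormal[OF S] by force
  ultimately have "independent S"
    by (rule pairwise_orthogonal_independent)
  then show ?thesis
    using independent_bound by blast
qed

text \<open>Take an orthonormal family of eigenvectors of greatest size and subtract its spectral
  sum. The rest \<open>B\<close> annihilates the family, so an eigenvector of \<open>B\<close> with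
  nonzero eigenvalue is orthogonal to it, hence an eigenvector of \<open>A\<close> as well, and
  would enlarge the family.\<close>

theorem hermitian_spectral_decomposition:
  fixes A :: "'n::finite operator"
  assumes A: "hermitian A"
  obtains S c where "orthonormal S" "A = spectral_sum S c"
proof -
  define eig where "eig S \<longleftrightarrow> orthonormal S \<and> (\<forall>v\<in>S. \<exists>d. A *v v = d *\<^sub>R v)" for S
  have "eig {}"
    by (simp add: eig_def orthonormal_def)
  moreover have "\<forall>S. eig S \<longrightarrow> card S < Suc DIM(complex ^ 'n)"
    using orthonormal_card_le by (auto simp: eig_def less_Suc_eq_le)
  ultimately obtain S where S: "eig S" and max: "\<And>T. eig T \<Longrightarrow> card T \<le> card S"
    using ex_has_greatest_nat[of eig "{}" card] by blast
  then obtain c where c: "\<And>v. v \<in> S \<Longrightarrow> A *v v = c v *\<^sub>R v"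
    unfolding eig_def by metis
  have on: "orthonormal S"
    using S by (simp add: eig_def)
  define B where "B = A - spectral_sum S c"
  have B: "hermitian B"
    using A by (simp add: B_def hermitian_spectral_sum)
  have BS: "B *v v = 0" if "v \<in> S" for v
    using that by (simp add: B_def matrix_vector_mult_diff_rdistrib c spectral_sum_eigenvector[OF on])
  have "B = 0"
  proof (rule ccontr)
    assume "B \<noteq> 0"
    then obtain w d where w: "norm w = 1" "d \<noteq> 0" "B *v w = d *\<^sub>R w"
      using hermitian_eigenvector[OF B] by blast
    have orth: "cinner v w = 0" if "v \<in> S" for v
    proof -
      have "d * cinner v w = cinner v (B *v w)"
        by (simp add: w scale_of_real[symmetric] cinner_scale_right)
      also have "\<dots> = cinner (B *v v) w"
        by (metis B cinner_dagger)
      finally show ?thesis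
        using w that by (simp add: BS)
    qed
    then have orth': "cinner w v = 0" if "v \<in> S" for v
      using that by (metis cnj_cinner complex_cnj_zero)
    have "w \<notin> S"
      using orth[of w] cinner_self_unit[OF w(1)] by auto
    have "spectral_sum S c *v w = 0"
      by (simp add: spectral_sum_vector orth)
    then have "A *v w = d *\<^sub>R w"
      using w by (simp add: B_def matrix_vector_mult_diff_rdistrib)
    then have "eig (insert w S)"
      using on c orth orth' \<open>w \<notin> S\<close> cinner_self_unit[OF w(1)] by (auto simp: eig_def orthonormal_def)
    then have "card (insert w S) \<le> card S"
      by (rule max)
    then show False
      using \<open>w \<notin> S\<close> on by (simp add: orthonormal_def)
  qed
  then show thesis
    using that on by (simp add: B_def)
qed

section \<open>Positive square roots and the trace norm\<close>

text \<open>\<open>D = S - T\<close> satisfies \<open>S ** D + D ** T = 0\<close>. On an eigenvector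
  of \<open>D\<close> with nonzero eigenvalue this makes the two nonnegative forms of
  \<open>S\<close> and \<open>T\<close> add up to zero, so both operators, and therefore
  \<open>D\<close>, annihilate that vector.\<close>

lemma psd_sqrt_unique:
  assumes "psd S" "psd T" "S ** S = T ** T"
  shows "S = T"
proof (rule ccontr)
  define D where "D = S - T"
  assume "S \<noteq> T"
  then have "D \<noteq> 0" "hermitian D"
    using assms by (simp_all add: D_def psd_hermitian)
  then obtain v d where v: "norm v = 1" "d \<noteq> 0" "D *v v = d *\<^sub>R v"
    using hermitian_eigenvector by blast
  have "S ** D + D ** T = 0"
    by (simp add: D_def matrix_mult_diff assms)
  then have "S *v (D *v v) + D *v (T *v v) = 0"
    by (metis matrix_vector_mul_assoc matrix_vector_mult_0 matrix_vector_mult_add_rdistrib)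
  then have "cinner v (S *v (D *v v)) + cinner v (D *v (T *v v)) = 0"
    by (metis cinner_add_right cinner_zero(1))
  moreover have "cinner v (S *v (D *v v)) = d * cinner v (S *v v)"
    by (simp add: v scale_of_real[symmetric] matrix_scale_vector cinner_scale_right)
  moreover have "cinner v (D *v (T *v v)) = d * cinner v (T *v v)"
    using cinner_dagger[of v D "T *v v"]
    by (simp add: \<open>hermitian D\<close> v scale_of_real[symmetric] cinner_scale_left)
  ultimately have "d * (cinner v (S *v v) + cinner v (T *v v)) = 0"
    by (simp add: distrib_left)
  then have sum0: "cinner v (S *v v) + cinner v (T *v v) = 0"
    using v by simp
  then have "Re (cinner v (S *v v)) + Re (cinner v (T *v v)) = 0"
    by (metis plus_complex.sel(1) zero_complex.sel(1))
  then have "Re (cinner v (S *v v)) = 0" "Re (cinner v (T *v v)) = 0"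
    using psdD[OF assms(1), of v] psdD[OF assms(2), of v] by linarith+
  then have "cinner v (S *v v) = 0" "cinner v (T *v v) = 0"
    using hermitian_form_real assms psd_hermitian by (metis of_real_0)+
  then have "S *v v = 0" "T *v v = 0"
    using assms psd_form_zero by blast+
  then have "D *v v = 0"
    by (simp add: D_def matrix_vector_mult_diff_rdistrib)
  with v show False
    by auto
qed

lemma psd_sqrt_eqI: "psd B \<Longrightarrow> B ** B = A \<Longrightarrow> psd_sqrt A = B"
  unfolding psd_sqrt_def by (rule the_equality) (auto intro: psd_sqrt_unique)

lemma psd_spectral_decomposition:
  assumes "psd A"
  obtains S c where "orthonormal S" "A = spectral_sum S c" "\<And>v. v \<in> S \<Longrightarrow> 0 \<le> c v"
proof -
  obtain S c where S: "orthonormal S" "A = spectral_sum S c"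
    using hermitian_spectral_decomposition assms psd_hermitian by blast
  have "0 \<le> c v" if "v \<in> S" for v
    using psdD[OF assms, of v] norm_orthonormal[OF S(1) that]
    by (simp add: S spectral_sum_eigenvector[OF S(1) that] Re_cinner flip: power2_norm_eq_inner)
  with S that show thesis
    by blast
qed

lemma psd_sqrt_exists:
  assumes "psd A"
  obtains B where "psd B" "B ** B = A"
proof -
  obtain S c where S: "orthonormal S" "A = spectral_sum S c" "\<And>v. v \<in> S \<Longrightarrow> 0 \<le> c v"
    using psd_spectral_decomposition[OF assms] by blast
  have "spectral_sum S (\<lambda>v. sqrt (c v)) ** spectral_sum S (\<lambda>v. sqrt (c v)) = A"
    unfolding spectral_sum_mult[OF S(1)] S(2) unfolding spectral_sum_def
    by (rule sum.cong) (simp_all add: S(3))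
  moreover have "psd (spectral_sum S (\<lambda>v. sqrt (c v)))"
    by (rule psd_spectral_sum) (simp add: S(3))
  ultimately show thesis
    using that by blast
qed

text \<open>Identifies the library norm of matrices as the Hilbert-Schmidt norm, which an operator
  shares with its absolute value.\<close>

lemma norm_operator_sq: "(norm A)\<^sup>2 = Re (trace (dagger A ** A))" for A :: "'n::finite operator"
proof -
  have "(norm A)\<^sup>2 = (\<Sum>i\<in>UNIV. \<Sum>j\<in>UNIV. (cmod (A $ i $ j))\<^sup>2)"
    by (simp add: norm_vec_def L2_set_def sum_nonneg)
  also have "\<dots> = (\<Sum>j\<in>UNIV. \<Sum>i\<in>UNIV. (cmod (A $ i $ j))\<^sup>2)"
    by (rule sum.swap)
  also have "\<dots> = Re (trace (dagger A ** A))"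
    by (simp add: trace_def matrix_matrix_mult_def dagger_def cmod_power2)
       (simp add: power2_eq_square)
  finally show ?thesis .
qed

lemma norm_ketbra: "norm (ketbra v) = (norm v)\<^sup>2"
proof -
  have "(norm (ketbra v))\<^sup>2 = ((norm v)\<^sup>2)\<^sup>2"
    by (simp add: norm_operator_sq hermitian_ketbra trace_ketbra_mult ketbra_form cinner_self norm_power)
  then show ?thesis
    by (metis norm_ge_zero power2_eq_iff_nonneg zero_le_power2)
qed

lemma trace_le_norm: "Re (trace A) \<le> CARD('n) * norm A" for A :: "'n::finite operator"
proof -
  have "Re (trace A) = (\<Sum>i\<in>UNIV. Re (A $ i $ i))"
    by (simp add: trace_def)
  also have "\<dots> \<le> (\<Sum>i\<in>(UNIV :: 'n set). norm A)"
  proof (rule sum_mono)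
    fix i
    have "Re (A $ i $ i) \<le> cmod (A $ i $ i)"
      by (rule complex_Re_le_cmod)
    also have "\<dots> \<le> norm (A $ i)"
      by (rule Finite_Cartesian_Product.norm_nth_le)
    also have "\<dots> \<le> norm A"
      by (rule Finite_Cartesian_Product.norm_nth_le)
    finally show "Re (A $ i $ i) \<le> norm A" .
  qed
  finally show ?thesis
    by simp
qed

text \<open>The link between the trace norm and the topology. It gives positivity away from zero,
  boundedness of the quotients in \<open>restricted_norm\<close>, and the conversion of uniform
  continuity in \<open>dissipative_contraction\<close>.\<close>

lemma trace_norm_bounds:
  fixes X :: "'n::finite operator"
  shows "norm X \<le> trace_norm X" "trace_norm X \<le> CARD('n) * norm X"
proof -
  obtain B where B: "psd B" "B ** B = dagger X ** X"
    using psd_sqrt_exists[OF psd_gram] by metis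
  then have tn: "trace_norm X = Re (trace B)"
    by (simp add: trace_norm_def psd_sqrt_eqI)
  have "(norm X)\<^sup>2 = (norm B)\<^sup>2"
    using B by (simp add: norm_operator_sq psd_hermitian)
  then have nX: "norm X = norm B"
    by (simp add: power2_eq_iff_nonneg)
  then show "trace_norm X \<le> CARD('n) * norm X"
    using trace_le_norm[of B] by (simp add: tn)
  obtain S c where S: "orthonormal S" "B = spectral_sum S c" "\<And>v. v \<in> S \<Longrightarrow> 0 \<le> c v"
    using psd_spectral_decomposition[OF B(1)] by blast
  have "norm B \<le> (\<Sum>v\<in>S. c v)"
    unfolding S(2) spectral_sum_def
    by (rule sum_norm_le) (simp add: S(3) norm_ketbra norm_orthonormal[OF S(1)])
  then show "norm X \<le> trace_norm X"
    using trace_spectral_sum[OF S(1)] by (simp add: tn nX S(2))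
qed

lemma trace_norm_nonneg: "0 \<le> trace_norm X"
  using trace_norm_bounds(1)[of X] norm_ge_zero order_trans by blast

lemma trace_norm_pos: "X \<noteq> 0 \<Longrightarrow> 0 < trace_norm X"
  using trace_norm_bounds(1)[of X] by (metis less_le_trans zero_less_norm_iff)

lemma trace_norm_spectral_sum:
  assumes "orthonormal S"
  shows "trace_norm (spectral_sum S c) = (\<Sum>v\<in>S. \<bar>c v\<bar>)"
proof -
  have "spectral_sum S (\<lambda>v. \<bar>c v\<bar>) ** spectral_sum S (\<lambda>v. \<bar>c v\<bar>)
      = dagger (spectral_sum S c) ** spectral_sum S c"
    by (simp add: hermitian_spectral_sum spectral_sum_mult[OF assms] flip: abs_mult)
  then have "psd_sqrt (dagger (spectral_sum S c) ** spectral_sum S c) = spectral_sum S (\<lambda>v. \<bar>c v\<bar>)"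
    by (intro psd_sqrt_eqI psd_spectral_sum) auto
  then show ?thesis
    by (simp add: trace_norm_def trace_spectral_sum[OF assms])
qed

section \<open>Duality for the trace norm\<close>

lemma bessel:
  assumes "orthonormal S"
  shows "(\<Sum>v\<in>S. (cmod (cinner v w))\<^sup>2) \<le> (norm w)\<^sup>2"
proof -
  define p where "p = (\<Sum>v\<in>S. cinner v w *s v)"
  define s where "s = (\<Sum>v\<in>S. (cmod (cinner v w))\<^sup>2)"
  have wp: "w \<bullet> p = s"
  proof -
    have "cinner w p = (\<Sum>v\<in>S. cinner v w * cnj (cinner v w))"
      by (simp add: p_def cinner_sum_right cinner_scale_right cnj_cinner)
    also have "\<dots> = complex_of_real s"
      unfolding s_def of_real_sum complex_norm_square ..
    finally show ?thesis
      by (simp flip: Re_cinner)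
  qed
  have vp: "cinner v p = cinner v w" if "v \<in> S" for v
  proof -
    have "cinner v p = (\<Sum>u\<in>S. if u = v then cinner v w else 0)"
      unfolding p_def cinner_sum_right
      by (rule sum.cong) (use assms that in \<open>auto simp: cinner_scale_right orthonormal_def\<close>)
    then show ?thesis
      using assms that by (simp add: orthonormal_def)
  qed
  have "p \<bullet> p = s"
  proof -
    have "cinner p p = (\<Sum>v\<in>S. cinner v w * cinner p v)"
      unfolding p_def cinner_sum_right cinner_scale_right ..
    also have "\<dots> = (\<Sum>v\<in>S. cinner v w * cnj (cinner v w))"
      by (rule sum.cong) (auto simp: vp simp flip: cnj_cinner[of _ p])
    also have "\<dots> = complex_of_real s"
      unfolding s_def of_real_sum complex_norm_square ..
    finally show ?thesis
      by (simp flip: Re_cinner)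
  qed
  have "0 \<le> (w - p) \<bullet> (w - p)"
    by simp
  also have "\<dots> = w \<bullet> w - s"
    using wp \<open>p \<bullet> p = s\<close> by (simp add: inner_diff_left inner_diff_right inner_commute)
  finally show ?thesis
    by (simp add: s_def power2_norm_eq_inner)
qed

text \<open>Expanding \<open>A\<close> in its own eigenvectors leaves squared overlaps with
  \<open>S\<close>; Bessel's inequality for \<open>S\<close>, applied to each eigenvector of
  \<open>A\<close>, bounds their sum by one. So \<open>S\<close> may be incomplete and unrelated to
  \<open>A\<close>.\<close>

lemma sum_form_le_trace:
  assumes S: "orthonormal S" and A: "psd A"
  shows "(\<Sum>v\<in>S. Re (cinner v (A *v v))) \<le> Re (trace A)"
proof -
  obtain T c where T: "orthonormal T" "A = spectral_sum T c" "\<And>v. v \<in> T \<Longrightarrow> 0 \<le> c v"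
    using psd_spectral_decomposition[OF A] by blast
  have form: "Re (cinner v (A *v v)) = (\<Sum>w\<in>T. c w * (cmod (cinner v w))\<^sup>2)" for v
  proof -
    have "Re (cinner v (A *v v)) = Re (trace (A ** ketbra v))"
      by (simp only: trace_ketbra_mult[symmetric] trace_mul_sym[of A])
    also have "\<dots> = (\<Sum>w\<in>T. c w * (cmod (cinner v w))\<^sup>2)"
      by (simp add: T(2) trace_spectral_sum_mult ketbra_form)
    finally show ?thesis .
  qed
  have "(\<Sum>v\<in>S. Re (cinner v (A *v v))) = (\<Sum>w\<in>T. \<Sum>v\<in>S. c w * (cmod (cinner v w))\<^sup>2)"
    unfolding form by (rule sum.swap)
  also have "\<dots> = (\<Sum>w\<in>T. c w * (\<Sum>v\<in>S. (cmod (cinner v w))\<^sup>2))"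
    by (simp add: sum_distrib_left)
  also have "\<dots> \<le> (\<Sum>w\<in>T. c w)"
  proof (rule sum_mono)
    fix w assume "w \<in> T"
    then have "(\<Sum>v\<in>S. (cmod (cinner v w))\<^sup>2) \<le> 1"
      using bessel[OF S, of w] norm_orthonormal[OF T(1)] by simp
    then show "c w * (\<Sum>v\<in>S. (cmod (cinner v w))\<^sup>2) \<le> c w"
      using T(3)[OF \<open>w \<in> T\<close>] mult_left_le by blast
  qed
  finally show ?thesis
    by (simp add: T(2) trace_spectral_sum[OF T(1)])
qed

text \<open>The Hoelder half of the duality, for a multiplier diagonal in \<open>S\<close> with
  entries in [-1, 1]. It allows every positive splitting \<open>A - B\<close>, not only the Jordan
  one, because images of Jordan parts under a map need not be orthogonal any more.\<close>

lemma sign_sum_le_trace: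
  assumes S: "orthonormal S" and s: "\<And>v. v \<in> S \<Longrightarrow> \<bar>s v\<bar> \<le> 1" and A: "psd A" and B: "psd B"
  shows "Re (trace (spectral_sum S s ** (A - B))) \<le> Re (trace (A + B))"
proof -
  have "Re (trace (spectral_sum S s ** (A - B))) = (\<Sum>v\<in>S. s v * Re (cinner v ((A - B) *v v)))"
    by (rule trace_spectral_sum_mult)
  also have "\<dots> \<le> (\<Sum>v\<in>S. Re (cinner v ((A + B) *v v)))"
  proof (rule sum_mono)
    fix v assume "v \<in> S"
    define a b where "a = Re (cinner v (A *v v))" and "b = Re (cinner v (B *v v))"
    have ab: "0 \<le> a" "0 \<le> b"
      using A B by (simp_all add: a_def b_def psdD)
    have "s v * (a - b) \<le> \<bar>s v\<bar> * \<bar>a - b\<bar>"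
      by (metis abs_ge_self abs_mult)
    also have "\<dots> \<le> 1 * \<bar>a - b\<bar>"
      by (rule mult_right_mono) (simp_all add: s \<open>v \<in> S\<close>)
    also have "\<dots> \<le> a + b"
      using ab by simp
    finally show "s v * Re (cinner v ((A - B) *v v)) \<le> Re (cinner v ((A + B) *v v))"
      by (simp add: a_def b_def matrix_vector_mult_diff_rdistrib matrix_vector_mult_add_rdistrib
          cinner_diff_right cinner_add_right)
  qed
  also have "\<dots> \<le> Re (trace (A + B))"
    by (rule sum_form_le_trace[OF S psd_add[OF A B]])
  finally show ?thesis .
qed

lemma jordan_decomposition:
  assumes Y: "hermitian Y"
  obtains A B where "psd A" "psd B" "Y = A - B" "trace_norm Y = Re (trace (A + B))"
proof -
  obtain S c where S: "orthonormal S" "Y = spectral_sum S c"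
    using hermitian_spectral_decomposition[OF Y] by blast
  let ?A = "spectral_sum S (\<lambda>v. max (c v) 0)" and ?B = "spectral_sum S (\<lambda>v. max (- c v) 0)"
  have "psd ?A" "psd ?B"
    by (simp_all add: psd_spectral_sum)
  moreover have "Y = ?A - ?B"
    unfolding S(2) spectral_sum_linear by (rule arg_cong[of _ _ "spectral_sum S"]) auto
  moreover have "trace_norm Y = Re (trace (?A + ?B))"
    unfolding spectral_sum_linear trace_spectral_sum[OF S(1)] S(2) trace_norm_spectral_sum[OF S(1)]
    by (rule sum.cong) auto
  ultimately show thesis
    using that by blast
qed

lemma sign_sum_le_trace_norm:
  assumes S: "orthonormal S" and s: "\<And>v. v \<in> S \<Longrightarrow> \<bar>s v\<bar> \<le> 1" and Z: "hermitian Z"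
  shows "Re (trace (spectral_sum S s ** Z)) \<le> trace_norm Z"
proof -
  obtain A B where "psd A" "psd B" "Z = A - B" "trace_norm Z = Re (trace (A + B))"
    using jordan_decomposition[OF Z] by blast
  then show ?thesis
    using sign_sum_le_trace[of S s A B] S s by simp
qed

text \<open>A dual witness: a linear functional that attains the trace norm at \<open>Y\<close> and
  is dominated by it on Hermitian operators. With it, a bound on the norm of a sum or integral is a
  bound on a linear expression.\<close>

definition norming :: "'n::finite operator \<Rightarrow> 'n operator \<Rightarrow> bool" where
  "norming Q Y \<longleftrightarrow> Re (trace (Q ** Y)) = trace_norm Y \<and>
     (\<forall>Z. hermitian Z \<longrightarrow> Re (trace (Q ** Z)) \<le> trace_norm Z)"

text \<open>\<open>Q\<close> behaves like the sign of \<open>Y\<close>, and \<open>A + B\<close> is the absolute value of \<open>Y\<close>.\<close>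

definition sign_operator :: "'n::finite operator \<Rightarrow> 'n operator \<Rightarrow> bool" where
  "sign_operator Q Y \<longleftrightarrow> norming Q Y \<and>
     (\<exists>A B. psd A \<and> psd B \<and> Y = A - B \<and> Q ** Y = A + B \<and> Y ** Q = A + B)"

lemma sign_operator_exists:
  assumes Y: "hermitian Y"
  obtains Q where "sign_operator Q Y"
proof -
  obtain S c where S: "orthonormal S" "Y = spectral_sum S c"
    using hermitian_spectral_decomposition[OF Y] by blast
  let ?A = "spectral_sum S (\<lambda>v. max (c v) 0)" and ?B = "spectral_sum S (\<lambda>v. max (- c v) 0)"
    and ?Q = "spectral_sum S (\<lambda>v. sgn (c v))"
  have "psd ?A" "psd ?B"
    by (simp_all add: psd_spectral_sum)
  moreover have "Y = ?A - ?B"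
    unfolding S(2) spectral_sum_linear by (rule arg_cong[of _ _ "spectral_sum S"]) auto
  moreover have QY: "?Q ** Y = ?A + ?B"
    unfolding S(2) spectral_sum_linear spectral_sum_mult[OF S(1)]
    by (rule arg_cong[of _ _ "spectral_sum S"]) (auto simp: sgn_real_def max_def)
  moreover have "Y ** ?Q = ?A + ?B"
    unfolding S(2) spectral_sum_linear spectral_sum_mult[OF S(1)]
    by (rule arg_cong[of _ _ "spectral_sum S"]) (auto simp: sgn_real_def max_def)
  moreover have "norming ?Q Y"
    unfolding norming_def
  proof (intro conjI allI impI)
    show "Re (trace (?Q ** Y)) = trace_norm Y"
      unfolding S(2) spectral_sum_mult[OF S(1)] trace_spectral_sum[OF S(1)] trace_norm_spectral_sum[OF S(1)]
      by (rule sum.cong) (simp_all add: abs_sgn mult.commute)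
    show "Re (trace (?Q ** Z)) \<le> trace_norm Z" if "hermitian Z" for Z
      by (rule sign_sum_le_trace_norm[OF S(1) _ that]) (simp add: abs_sgn_eq)
  qed
  ultimately show thesis
    using that unfolding sign_operator_def by blast
qed

lemma norming_exists: "hermitian Y \<Longrightarrow> \<exists>Q. norming Q Y"
  using sign_operator_exists unfolding sign_operator_def by metis

text \<open>Among the positive splittings of a Hermitian operator the Jordan one has the least total
  trace.\<close>

lemma trace_norm_diff_le:
  assumes "psd A" "psd B"
  shows "trace_norm (A - B) \<le> Re (trace (A + B))"
proof -
  have "hermitian (A - B)"
    using assms by (simp add: psd_hermitian)
  then obtain S c where S: "orthonormal S" "A - B = spectral_sum S c"
    using hermitian_spectral_decomposition by blast
  have "trace_norm (A - B) = Re (trace (spectral_sum S (\<lambda>v. sgn (c v)) ** (A - B)))"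
    unfolding S(2) spectral_sum_mult[OF S(1)] trace_spectral_sum[OF S(1)] trace_norm_spectral_sum[OF S(1)]
    by (rule sum.cong) (simp_all add: abs_sgn mult.commute)
  also have "\<dots> \<le> Re (trace (A + B))"
    by (rule sign_sum_le_trace[OF S(1) _ assms]) (simp add: abs_sgn_eq)
  finally show ?thesis .
qed

lemma trace_norm_triangle:
  assumes "hermitian X" "hermitian Y"
  shows "trace_norm (X + Y) \<le> trace_norm X + trace_norm Y"
proof -
  obtain Q where Q: "norming Q (X + Y)"
    using norming_exists[of "X + Y"] assms by auto
  then have "trace_norm (X + Y) = Re (trace (Q ** X)) + Re (trace (Q ** Y))"
    by (simp add: norming_def matrix_add_ldistrib trace_add)
  also have "\<dots> \<le> trace_norm X + trace_norm Y"
    using Q assms by (simp add: norming_def add_mono)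
  finally show ?thesis .
qed

lemma trace_norm_scaleR_le:
  assumes "hermitian X" "0 \<le> r"
  shows "trace_norm (r *\<^sub>R X) \<le> r * trace_norm X"
proof -
  obtain Q where Q: "norming Q (r *\<^sub>R X)"
    using norming_exists[of "r *\<^sub>R X"] assms by auto
  then have "trace_norm (r *\<^sub>R X) = r * Re (trace (Q ** X))"
    by (simp add: norming_def matrix_mult_scaleR trace_scaleR)
  also have "\<dots> \<le> r * trace_norm X"
    using Q assms by (intro mult_left_mono) (simp_all add: norming_def)
  finally show ?thesis .
qed

lemma trace_norm_minus: "trace_norm (- X) = trace_norm X"
proof -
  have "dagger (- X) ** (- X) = dagger X ** X"
    by (simp add: vec_eq_iff dagger_def matrix_matrix_mult_def)
  then show ?thesis
    by (simp add: trace_norm_def)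
qed

lemma form_le_trace_norm:
  assumes "hermitian Z" "norm v = 1"
  shows "\<bar>Re (cinner v (Z *v v))\<bar> \<le> trace_norm Z"
proof -
  have on: "orthonormal {v}"
    using assms by (simp add: orthonormal_def cinner_self)
  show ?thesis
    using sign_sum_le_trace_norm[OF on, of "\<lambda>_. 1" Z] sign_sum_le_trace_norm[OF on, of "\<lambda>_. - 1" Z] assms
    by (simp add: trace_spectral_sum_mult)
qed

text \<open>Duality with the observable \<open>ketbra u - ketbra v\<close>. Testing \<open>u\<close>
  and \<open>v\<close> jointly costs one trace norm of \<open>Z\<close>, where two separate tests
  would cost two.\<close>

lemma orthogonal_forms_le_trace_norm:
  assumes "hermitian Z" "norm u = 1" "norm v = 1" "cinner u v = 0"
  shows "Re (cinner u (Z *v u)) - Re (cinner v (Z *v v)) \<le> trace_norm Z"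
proof -
  have vu: "cinner v u = 0" and "u \<noteq> v"
    using assms cnj_cinner[of u v] by (auto simp: cinner_self)
  then have on: "orthonormal {u, v}"
    using assms by (auto simp: orthonormal_def cinner_self)
  show ?thesis
    using sign_sum_le_trace_norm[OF on, of "\<lambda>w. if w = u then 1 else - 1" Z] assms(1) \<open>u \<noteq> v\<close>
    by (simp add: trace_spectral_sum_mult)
qed

lemma hermitian_decomposition:
  obtains H K where "hermitian H" "hermitian K" "X = H + \<i> \<cdot>\<^sub>C K"
proof -
  let ?H = "(1/2) *\<^sub>R (X + dagger X)" and ?K = "(1/2) *\<^sub>R ((- \<i>) \<cdot>\<^sub>C (X - dagger X))"
  have "hermitian ?H" "hermitian ?K"
    by (simp_all add: add.commute) (simp add: vec_eq_iff cscale_def dagger_def algebra_simps)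
  moreover have "X = ?H + \<i> \<cdot>\<^sub>C ?K"
    by (simp add: vec_eq_iff cscale_def dagger_def complex_eq_iff field_simps)
  ultimately show thesis
    using that by blast
qed

section \<open>The exponential of a superoperator\<close>

lemma clinear_linear: "clinear_superop M \<Longrightarrow> linear M"
  unfolding clinear_superop_def by (intro linearI) (simp_all flip: cscale_of_real)

lemma bounded_linear_operator: "linear f \<Longrightarrow> bounded_linear f" for f :: "'n::finite operator \<Rightarrow> 'a::real_normed_vector"
  by (simp add: linear_conv_bounded_linear)

lemma linear_funpow:
  assumes "linear M"
  shows "linear ((M :: 'a::real_vector \<Rightarrow> 'a) ^^ k)"
proof (induction k)
  case 0
  show ?case
    by (simp add: linear_id[unfolded id_def] linear_iff)
next
  case (Suc k)
  show ?case
    using linear_compose[OF Suc assms] by (simp add: o_def)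
qed

lemma superop_exp_summable:
  fixes M :: "'n::finite superoperator"
  assumes "linear M"
  shows "summable (\<lambda>k. (t ^ k / fact k) *\<^sub>R (M ^^ k) X)"
proof -
  obtain B where B: "0 < B" "\<And>X. norm (M X) \<le> B * norm X"
    using linear_bounded_pos[OF assms] by blast
  have pow: "norm ((M ^^ k) X) \<le> B ^ k * norm X" for k
  proof (induction k)
    case (Suc k)
    have "norm ((M ^^ Suc k) X) \<le> B * norm ((M ^^ k) X)"
      by (simp add: B)
    also have "\<dots> \<le> B * (B ^ k * norm X)"
      using B Suc.IH by (intro mult_left_mono) auto
    finally show ?case
      by simp
  qed simp
  have "summable (\<lambda>k. inverse (fact k) * (\<bar>t\<bar> * B) ^ k * norm X)"
    by (intro summable_mult2 summable_exp)
  then show ?thesis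
  proof (rule summable_comparison_test')
    fix k :: nat
    have "norm ((t ^ k / fact k) *\<^sub>R (M ^^ k) X) = inverse (fact k) * \<bar>t\<bar> ^ k * norm ((M ^^ k) X)"
      by (simp add: power_abs abs_mult divide_inverse mult_ac)
    also have "\<dots> \<le> inverse (fact k) * \<bar>t\<bar> ^ k * (B ^ k * norm X)"
      by (intro mult_left_mono pow) simp
    finally show "norm ((t ^ k / fact k) *\<^sub>R (M ^^ k) X) \<le> inverse (fact k) * (\<bar>t\<bar> * B) ^ k * norm X"
      by (simp add: power_mult_distrib mult_ac)
  qed
qed

lemma superop_exp_linear_image:
  fixes M :: "'n::finite superoperator" and h :: "'n operator \<Rightarrow> 'b::real_normed_vector"
  assumes "linear M" "linear h"
  shows "h (superop_exp M t X) = (\<Sum>k. (t ^ k / fact k) *\<^sub>R h ((M ^^ k) X))"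
  unfolding superop_exp_def
  by (simp add: bounded_linear.suminf[OF bounded_linear_operator[OF assms(2)] superop_exp_summable[OF assms(1)]]
      linear_scale[OF assms(2)])

lemma superop_exp_commute:
  fixes M :: "'n::finite superoperator"
  assumes "linear M"
  shows "superop_exp M t (M X) = M (superop_exp M t X)"
  unfolding superop_exp_linear_image[OF assms assms] unfolding superop_exp_def by (simp add: funpow_swap1)

lemma linear_superop_exp:
  fixes M :: "'n::finite superoperator"
  assumes "linear M"
  shows "linear (superop_exp M t)"
proof (rule linearI)
  note lin = linear_funpow[OF assms]
  show "superop_exp M t (X + Y) = superop_exp M t X + superop_exp M t Y" for X Y
    unfolding superop_exp_def
    by (simp add: linear_add[OF lin] scaleR_add_right suminf_add superop_exp_summable[OF assms])
  show "superop_exp M t (r *\<^sub>R X) = r *\<^sub>R superop_exp M t X" for r X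
    unfolding superop_exp_def
    using suminf_scaleR_right[OF superop_exp_summable[OF assms], of r t X]
    by (simp add: linear_scale[OF lin] mult.commute)
qed

lemma superop_exp_0 [simp]: "superop_exp M 0 X = X"
proof -
  have "superop_exp M 0 X = (\<Sum>k\<in>{0}. (0 ^ k / fact k) *\<^sub>R (M ^^ k) X)"
    unfolding superop_exp_def by (rule suminf_finite) auto
  then show ?thesis
    by simp
qed

text \<open>Tested against a fixed vector, the exponential is an everywhere convergent scalar power
  series, and \<open>diffs\<close> shifts its coefficients to those belonging to
  \<open>M X\<close>.\<close>

lemma superop_exp_derivative:
  fixes M :: "'n::finite superoperator"
  assumes "linear M"
  shows "((\<lambda>t. superop_exp M t X) has_vector_derivative superop_exp M t (M X)) (at t within S)"
proof -
  have "((\<lambda>t. superop_exp M t X \<bullet> b) has_real_derivative superop_exp M t (M X) \<bullet> b) (at t)" for b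
  proof -
    have inner: "superop_exp M t Y \<bullet> b = (\<Sum>k. ((M ^^ k) Y \<bullet> b) / fact k * t ^ k)" for t Y
      unfolding superop_exp_linear_image[OF assms bounded_linear.linear[OF bounded_linear_inner_left]]
      by (simp add: mult.commute)
    have "summable (\<lambda>k. ((M ^^ k) X \<bullet> b) / fact k * y ^ k)" for y
      using bounded_linear.summable[OF bounded_linear_inner_left superop_exp_summable[OF assms], of y X b]
      by (simp add: mult.commute)
    then have "((\<lambda>t. \<Sum>k. ((M ^^ k) X \<bullet> b) / fact k * t ^ k) has_real_derivative
        (\<Sum>k. diffs (\<lambda>k. ((M ^^ k) X \<bullet> b) / fact k) k * t ^ k)) (at t)"
      by (rule termdiffs_strong_converges_everywhere)
    moreover have "diffs (\<lambda>k. ((M ^^ k) X \<bullet> b) / fact k) = (\<lambda>k. ((M ^^ k) (M X) \<bullet> b) / fact k)"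
      by (rule ext) (simp add: diffs_def funpow_swap1 field_simps del: of_nat_Suc)
    ultimately show ?thesis
      by (simp add: inner)
  qed
  then have "((\<lambda>t. superop_exp M t X) has_vector_derivative superop_exp M t (M X)) (at t)"
    unfolding has_vector_derivative_def
    by (subst has_derivative_componentwise_within) (simp add: has_field_derivative_def mult_commute_abs)
  then show ?thesis
    by (rule has_vector_derivative_at_within)
qed

text \<open>Separates time from the operator argument: a finite sum of fixed curves with scalar
  coefficients. The product rule and joint continuity follow from this without a norm on
  superoperators.\<close>

lemma superop_exp_expand:
  fixes M :: "'n::finite superoperator"
  assumes "linear M"
  shows "superop_exp M t X = (\<Sum>b\<in>Basis. (X \<bullet> b) *\<^sub>R superop_exp M t b)"
proof -
  have "superop_exp M t X = superop_exp M t (\<Sum>b\<in>Basis. (X \<bullet> b) *\<^sub>R b)"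
    by (simp add: euclidean_representation)
  then show ?thesis
    by (simp add: linear_sum[OF linear_superop_exp[OF assms]] linear_scale[OF linear_superop_exp[OF assms]])
qed

lemma superop_exp_product_derivative:
  assumes M: "linear M"
    and f: "(f has_real_derivative f') (at t within S)"
    and Z: "(Z has_vector_derivative Z') (at t within S)"
  shows "((\<lambda>t. superop_exp M (f t) (Z t)) has_vector_derivative
     superop_exp M (f t) (f' *\<^sub>R M (Z t) + Z')) (at t within S)"
proof -
  note lin = linear_superop_exp[OF M]
  have 1: "((\<lambda>t. superop_exp M (f t) b) has_vector_derivative f' *\<^sub>R superop_exp M (f t) (M b))
      (at t within S)" for b
    using vector_diff_chain_within[OF f[unfolded has_real_derivative_iff_has_vector_derivative]
        superop_exp_derivative[OF M]] by (simp add: o_def)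
  have 2: "((\<lambda>t. Z t \<bullet> b) has_real_derivative Z' \<bullet> b) (at t within S)" for b
    using bounded_linear.has_vector_derivative[OF bounded_linear_inner_left Z]
    by (simp add: has_real_derivative_iff_has_vector_derivative)
  have "((\<lambda>t. \<Sum>b\<in>Basis. (Z t \<bullet> b) *\<^sub>R superop_exp M (f t) b) has_vector_derivative
      (\<Sum>b\<in>Basis. (Z t \<bullet> b) *\<^sub>R (f' *\<^sub>R superop_exp M (f t) (M b))
        + (Z' \<bullet> b) *\<^sub>R superop_exp M (f t) b)) (at t within S)"
    by (intro has_vector_derivative_sum has_vector_derivative_scaleR 1 2)
  moreover have "(\<Sum>b\<in>Basis. (Z t \<bullet> b) *\<^sub>R (f' *\<^sub>R superop_exp M (f t) (M b))
        + (Z' \<bullet> b) *\<^sub>R superop_exp M (f t) b) = superop_exp M (f t) (f' *\<^sub>R M (Z t) + Z')"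
  proof -
    have "M (Z t) = M (\<Sum>b\<in>Basis. (Z t \<bullet> b) *\<^sub>R b)"
      by (simp add: euclidean_representation)
    also have "\<dots> = (\<Sum>b\<in>Basis. (Z t \<bullet> b) *\<^sub>R M b)"
      by (simp add: linear_sum[OF M] linear_scale[OF M])
    finally have "superop_exp M (f t) (f' *\<^sub>R M (Z t)) =
        (\<Sum>b\<in>Basis. (Z t \<bullet> b) *\<^sub>R (f' *\<^sub>R superop_exp M (f t) (M b)))"
      by (simp add: linear_sum[OF lin] linear_scale[OF lin] scaleR_sum_right mult.commute)
    then show ?thesis
      by (simp add: sum.distrib linear_add[OF lin] flip: superop_exp_expand[OF M, of _ Z'])
  qed
  ultimately show ?thesis
    by (simp flip: superop_exp_expand[OF M])
qed

lemma superop_exp_continuous_on: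
  assumes M: "linear M" and "continuous_on S f" "continuous_on S Z"
  shows "continuous_on S (\<lambda>t. superop_exp M (f t) (Z t))"
proof -
  have "continuous_on UNIV (\<lambda>t. superop_exp M t b)" for b
    using superop_exp_derivative[OF M] by (intro continuous_on_vector_derivative)
  then have "continuous_on S (\<lambda>t. superop_exp M (f t) b)" for b
    using continuous_on_compose2[OF _ assms(2)] by blast
  then have "continuous_on S (\<lambda>t. \<Sum>b\<in>Basis. (Z t \<bullet> b) *\<^sub>R superop_exp M (f t) b)"
    by (intro continuous_intros assms)
  then show ?thesis
    by (simp flip: superop_exp_expand[OF M])
qed

text \<open>The curve \<open>?h\<close> has derivative zero; its values at \<open>0\<close> and at
  \<open>t\<close> are the two sides. Times may be negative, and the interaction picture in
  \<open>dyson_term\<close> depends on that.\<close>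

lemma superop_exp_add:
  assumes M: "linear M"
  shows "superop_exp M (s + t) X = superop_exp M s (superop_exp M t X)"
proof -
  let ?h = "\<lambda>u. superop_exp M (s + t - u) (superop_exp M u X)"
  have "(?h has_vector_derivative 0) (at u within UNIV)" for u
  proof -
    have "((\<lambda>u. s + t - u) has_real_derivative - 1) (at u within UNIV)"
      by (auto intro!: derivative_eq_intros)
    from superop_exp_product_derivative[OF M this superop_exp_derivative[OF M]]
    show ?thesis
      by (simp add: superop_exp_commute[OF M] linear_0[OF linear_superop_exp[OF M]])
  qed
  then obtain c where "\<And>u. ?h u = c"
    using has_vector_derivative_zero_constant[of UNIV ?h] by auto
  from this[of 0] this[of t] show ?thesis
    by simp
qed

text \<open>The integral is orthogonal to \<open>V\<^sup>\<bottom>\<close>, hence lies in the double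
  complement, which is \<open>V\<close> in finite dimension. It is used for Hermitian operators,
  traceless operators and error spans.\<close>

lemma integral_in_subspace:
  fixes f :: "real \<Rightarrow> 'a::euclidean_space"
  assumes V: "subspace V" and f: "f integrable_on I" "\<And>x. x \<in> I \<Longrightarrow> f x \<in> V"
  shows "integral I f \<in> V"
proof -
  have "y \<bullet> integral I f = 0" if "y \<in> V\<^sup>\<bottom>" for y
  proof -
    have "y \<bullet> integral I f = integral I (\<lambda>x. y \<bullet> f x)"
      using integral_linear[OF f(1) bounded_linear_inner_right] by (simp add: o_def)
    also have "\<dots> = integral I (\<lambda>x. 0)"
      by (rule integral_cong)
         (use that f(2) in \<open>auto simp: orthogonal_comp_def orthogonal_def inner_commute\<close>)
    finally show ?thesis
      by simp
  qed
  then have "integral I f \<in> V\<^sup>\<bottom>\<^sup>\<bottom>"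
    by (simp add: orthogonal_comp_def orthogonal_def)
  then show ?thesis
    by (simp add: orthogonal_comp_self[OF V])
qed

lemma integral_linear_image:
  fixes f :: "real \<Rightarrow> 'n::finite operator" and h :: "'n operator \<Rightarrow> 'b::banach"
  assumes "linear h" "f integrable_on S"
  shows "h (integral S f) = integral S (\<lambda>x. h (f x))"
  using integral_linear[OF assms(2) bounded_linear_operator[OF assms(1)]] by (simp add: o_def)

text \<open>The functional is chosen for the integral and then moved inside, so integrability is
  needed for the linear expression and for \<open>g\<close>, but never for the trace norm of
  \<open>f x\<close>.\<close>

lemma trace_norm_integral_le:
  fixes f :: "real \<Rightarrow> 'n::finite operator"
  assumes f: "continuous_on {a..b} f" and g: "continuous_on {a..b} g"
    and herm: "\<And>x. x \<in> {a..b} \<Longrightarrow> hermitian (f x)"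
    and le: "\<And>x. x \<in> {a..b} \<Longrightarrow> trace_norm (f x) \<le> g x"
  shows "trace_norm (integral {a..b} f) \<le> integral {a..b} g"
proof -
  have int: "f integrable_on {a..b}"
    by (rule integrable_continuous_real[OF f])
  have "hermitian (integral {a..b} f)"
    using integral_in_subspace[OF subspace_hermitian int] herm by simp
  then obtain Q where Q: "norming Q (integral {a..b} f)"
    using norming_exists by blast
  then have "trace_norm (integral {a..b} f) = Re (trace (Q ** integral {a..b} f))"
    by (simp add: norming_def)
  also have "\<dots> = integral {a..b} (\<lambda>x. Re (trace (Q ** f x)))"
    by (rule integral_linear_image[OF linear_Re_trace int])
  also have "\<dots> \<le> integral {a..b} g"
  proof (rule integral_le)
    show "(\<lambda>x. Re (trace (Q ** f x))) integrable_on {a..b}"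
      by (intro integrable_continuous_real linear_continuous_on_compose[OF f] linear_Re_trace)
    show "g integrable_on {a..b}"
      by (rule integrable_continuous_real[OF g])
    show "Re (trace (Q ** f x)) \<le> g x" if "x \<in> {a..b}" for x
      using Q herm[OF that] le[OF that] unfolding norming_def by (metis order_trans)
  qed
  finally show ?thesis .
qed

text \<open>Variation of constants, from the derivative of \<open>s \<mapsto> e\<^bsup>M(t-s)\<^esup> (Z s)\<close>.\<close>

lemma duhamel:
  assumes M: "linear M" and "0 \<le> t"
    and Z: "\<And>s. s \<in> {0..t} \<Longrightarrow> (Z has_vector_derivative M (Z s) - r s) (at s within {0..t})"
  shows "superop_exp M t (Z 0) = Z t + integral {0..t} (\<lambda>s. superop_exp M (t - s) (r s))"
proof -
  have "((\<lambda>s. superop_exp M (t - s) (Z s)) has_vector_derivative - superop_exp M (t - s) (r s))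
      (at s within {0..t})" if "s \<in> {0..t}" for s
  proof -
    have "((\<lambda>s. t - s) has_real_derivative - 1) (at s within {0..t})"
      by (auto intro!: derivative_eq_intros)
    from superop_exp_product_derivative[OF M this Z[OF that]] show ?thesis
      by (simp add: linear_neg[OF linear_superop_exp[OF M]])
  qed
  from fundamental_theorem_of_calculus[OF \<open>0 \<le> t\<close> this]
  have "((\<lambda>s. - superop_exp M (t - s) (r s)) has_integral Z t - superop_exp M t (Z 0)) {0..t}"
    by simp
  from has_integral_neg[OF this] have "integral {0..t} (\<lambda>s. superop_exp M (t - s) (r s)) =
      superop_exp M t (Z 0) - Z t"
    by (simp add: integral_unique)
  then show ?thesis
    by simp
qed

section \<open>Positive maps, dissipativity and contraction\<close>

lemma cptp_psd:
  assumes "cptp \<Phi>" "psd X"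
  shows "psd (\<Phi> X)"
proof -
  have "block_psd 1 (\<lambda>i j. X)"
    using assms(2) by (simp add: block_psd_def psd_def)
  then have "block_psd 1 (\<lambda>i j. \<Phi> X)"
    using assms(1) by (auto simp: cptp_def completely_positive_def)
  then have "cinner v (\<Phi> X *v v) \<in> \<real>\<^sub>\<ge>\<^sub>0" for v
    using spec[of _ "\<lambda>_. v"] unfolding block_psd_def by fastforce
  then show ?thesis
    by (simp add: psd_def)
qed

definition positive_trace_preserving :: "'n::finite superoperator \<Rightarrow> bool" where
  "positive_trace_preserving \<Phi> \<longleftrightarrow>
     clinear_superop \<Phi> \<and> (\<forall>X. psd X \<longrightarrow> psd (\<Phi> X)) \<and> (\<forall>X. trace (\<Phi> X) = trace X)"

lemma cptp_positive_trace_preserving: "cptp \<Phi> \<Longrightarrow> positive_trace_preserving \<Phi>"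
  using cptp_psd by (auto simp: positive_trace_preserving_def cptp_def)

text \<open>The images of the Jordan parts are positive with unchanged traces. They may overlap, but
  \<open>trace_norm_diff_le\<close> accepts any positive splitting.\<close>

lemma positive_hermitian_contraction:
  assumes \<Phi>: "positive_trace_preserving \<Phi>" and X: "hermitian X"
  shows "hermitian (\<Phi> X)" "trace_norm (\<Phi> X) \<le> trace_norm X"
proof -
  obtain A B where AB: "psd A" "psd B" "X = A - B" "trace_norm X = Re (trace (A + B))"
    using jordan_decomposition[OF X] by blast
  have lin: "linear \<Phi>"
    using \<Phi> clinear_linear by (auto simp: positive_trace_preserving_def)
  have pos: "psd (\<Phi> A)" "psd (\<Phi> B)"
    using \<Phi> AB by (auto simp: positive_trace_preserving_def)
  have "\<Phi> X = \<Phi> A - \<Phi> B"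
    by (simp add: AB linear_diff[OF lin])
  then show "hermitian (\<Phi> X)" "trace_norm (\<Phi> X) \<le> trace_norm X"
    using pos trace_norm_diff_le[OF pos] \<Phi>
    by (simp_all add: psd_hermitian AB(4) positive_trace_preserving_def trace_add)
qed

text \<open>Infinitesimal contraction: the sign functional of \<open>Y\<close> does not increase in
  the direction \<open>M Y\<close>. Unlike contraction of the semigroup, this is visibly additive in
  \<open>M\<close>. Sign operators replace general norming functionals because the Lindblad form
  needs \<open>Q ** Y\<close> and \<open>Y ** Q\<close> to be the absolute value of
  \<open>Y\<close>.\<close>

definition dissipative :: "'n::finite superoperator \<Rightarrow> bool" where
  "dissipative M \<longleftrightarrow> (\<forall>Y. hermitian Y \<longrightarrow> hermitian (M Y)) \<and>
     (\<forall>Q Y. hermitian Y \<longrightarrow> sign_operator Q Y \<longrightarrow> Re (trace (Q ** M Y)) \<le> 0)"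

lemma dissipative_add:
  "dissipative M \<Longrightarrow> dissipative M' \<Longrightarrow> dissipative (\<lambda>X. M X + M' X)"
  unfolding dissipative_def by (simp add: matrix_add_ldistrib trace_add) (metis add_nonpos_nonpos)

lemma dissipative_scaleR: "dissipative M \<Longrightarrow> 0 \<le> r \<Longrightarrow> dissipative (\<lambda>X. r *\<^sub>R M X)"
  unfolding dissipative_def by (simp add: matrix_mult_scaleR trace_scaleR mult_nonneg_nonpos)

lemma dissipative_sum:
  "(\<And>i. i \<in> I \<Longrightarrow> dissipative (f i)) \<Longrightarrow> dissipative (\<lambda>X. \<Sum>i\<in>I. f i X)"
proof (induction I rule: infinite_finite_induct)
  case (insert i I)
  then show ?case
    using dissipative_add[of "f i" "\<lambda>X. \<Sum>i\<in>I. f i X"] by simp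
qed (auto simp: dissipative_def trace_0[unfolded mat_def] trace_def)

text \<open>Write \<open>G\<close> for \<open>dagger E ** E\<close>. Each half of the
  anticommutator, tested with \<open>Q\<close>, gives exactly \<open>trace (G ** (A + B))\<close>,
  where \<open>A + B\<close> is the absolute value of \<open>Y\<close>; the jump term gives at most
  the same number, by duality and cyclicity of the trace.\<close>

lemma dissipative_error_term:
  "dissipative (\<lambda>\<rho>. E ** \<rho> ** dagger E - (1/2) *\<^sub>R (dagger E ** E ** \<rho> + \<rho> ** (dagger E ** E)))"
  unfolding dissipative_def
proof (intro conjI allI impI)
  fix Y Q :: "'a operator"
  assume Y: "hermitian Y"
  show "hermitian (E ** Y ** dagger E - (1/2) *\<^sub>R (dagger E ** E ** Y + Y ** (dagger E ** E)))"
    using Y by (simp add: matrix_mul_assoc add.commute)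
  assume "sign_operator Q Y"
  then obtain A B where AB: "psd A" "psd B" "Y = A - B" "Q ** Y = A + B" "Y ** Q = A + B"
    and Q: "norming Q Y"
    unfolding sign_operator_def by blast
  define G where "G = dagger E ** E"
  have 1: "trace (Q ** (G ** Y)) = trace (G ** (A + B))"
    using trace_mul_sym[of Q "G ** Y"] by (simp add: AB(5) flip: matrix_mul_assoc)
  have 2: "trace (Q ** (Y ** G)) = trace (G ** (A + B))"
    using trace_mul_sym[of "A + B" G] by (simp add: matrix_mul_assoc AB(4))
  have EYE: "E ** Y ** dagger E = E ** A ** dagger E - E ** B ** dagger E"
    by (simp add: AB(3) matrix_mult_diff)
  have "hermitian (E ** Y ** dagger E)"
    using Y by (simp add: matrix_mul_assoc)
  then have "Re (trace (Q ** (E ** Y ** dagger E))) \<le> trace_norm (E ** Y ** dagger E)"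
    using Q by (simp add: norming_def)
  also have "trace_norm (E ** Y ** dagger E) \<le> Re (trace (E ** A ** dagger E + E ** B ** dagger E))"
    unfolding EYE by (intro trace_norm_diff_le psd_sandwich AB)
  also have "E ** A ** dagger E + E ** B ** dagger E = E ** (A + B) ** dagger E"
    by (simp add: matrix_add_ldistrib matrix_add_rdistrib)
  also have "trace \<dots> = trace (G ** (A + B))"
    using trace_mul_sym[of "E ** (A + B)" "dagger E"] by (simp add: G_def matrix_mul_assoc)
  finally show "Re (trace (Q ** (E ** Y ** dagger E
      - (1/2) *\<^sub>R (dagger E ** E ** Y + Y ** (dagger E ** E))))) \<le> 0"
    by (simp add: matrix_mult_diff matrix_mult_scaleR matrix_add_ldistrib trace_sub trace_add trace_scaleR
        1 2 flip: G_def)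
qed

lemma linear_error_lindbladian: "linear (error_lindbladian N lam E)"
proof -
  have "linear (\<lambda>\<rho>. lam \<mu> *\<^sub>R (E \<mu> ** \<rho> ** dagger (E \<mu>)
        - (1/2) *\<^sub>R (dagger (E \<mu>) ** E \<mu> ** \<rho> + \<rho> ** (dagger (E \<mu>) ** E \<mu>))))" for \<mu>
    by (rule linearI) (simp_all add: matrix_add_ldistrib matrix_add_rdistrib matrix_mult_scaleR algebra_simps)
  then show ?thesis
    unfolding error_lindbladian_def by (intro linear_compose_sum ballI)
qed

lemma dissipative_error_lindbladian:
  assumes "\<And>\<mu>. \<mu> \<in> {1..N} \<Longrightarrow> 0 \<le> lam \<mu>"
  shows "dissipative (error_lindbladian N lam E)"
  unfolding error_lindbladian_def
  by (intro dissipative_sum dissipative_scaleR dissipative_error_term assms)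

lemma trace_error_lindbladian: "trace (error_lindbladian N lam E \<rho>) = 0"
proof -
  have "trace (E \<mu> ** \<rho> ** dagger (E \<mu>)) = trace (dagger (E \<mu>) ** E \<mu> ** \<rho>)" for \<mu>
    using trace_mul_sym[of "E \<mu> ** \<rho>" "dagger (E \<mu>)"] by (simp add: matrix_mul_assoc)
  moreover have "trace (\<rho> ** (dagger (E \<mu>) ** E \<mu>)) = trace (dagger (E \<mu>) ** E \<mu> ** \<rho>)" for \<mu>
    by (rule trace_mul_sym)
  ultimately show ?thesis
    by (simp add: error_lindbladian_def linear_sum[OF linear_trace] trace_scaleR trace_sub trace_add)
qed

lemma superop_exp_quotient_tendsto:
  fixes M :: "'n::finite superoperator"
  assumes "linear M"
  shows "((\<lambda>h. (1 / h) *\<^sub>R (superop_exp M h Y - Y)) \<longlongrightarrow> M Y) (at_right 0)"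
proof -
  have "((\<lambda>t. superop_exp M t Y) has_vector_derivative M Y) (at_right 0)"
    using superop_exp_derivative[OF assms, of Y 0] by simp
  then have "((\<lambda>h. (1 / norm (h - 0)) *\<^sub>R
      (superop_exp M h Y - (superop_exp M 0 Y + (h - 0) *\<^sub>R M Y))) \<longlongrightarrow> 0) (at_right 0)"
    unfolding has_vector_derivative_def has_derivative_within by blast
  moreover have "\<forall>\<^sub>F h in at_right 0. (1 / norm (h - 0)) *\<^sub>R
      (superop_exp M h Y - (superop_exp M 0 Y + (h - 0) *\<^sub>R M Y))
      = (1 / h) *\<^sub>R (superop_exp M h Y - Y) - M Y"
    using eventually_at_right_less[of "0 :: real"]
    by eventually_elim (simp add: algebra_simps)
  ultimately have "((\<lambda>h. (1 / h) *\<^sub>R (superop_exp M h Y - Y) - M Y) \<longlongrightarrow> 0) (at_right 0)"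
    by (rule Lim_transform_eventually)
  then show ?thesis
    by (rule LIM_zero_cancel)
qed

text \<open>The functional of the sign of \<open>Y\<close> equals the trace norm at \<open>Y\<close>
  and is at most that norm at every later point, by contraction. So its difference quotients are
  nonpositive, and their limit is the value at \<open>M Y\<close>.\<close>

lemma dissipative_lindbladian:
  assumes M: "linear M" and pos: "\<And>t. 0 \<le> t \<Longrightarrow> positive_trace_preserving (superop_exp M t)"
  shows "dissipative M"
  unfolding dissipative_def
proof (intro conjI allI impI)
  fix Y Q :: "'a operator"
  assume Y: "hermitian Y"
  define q where "q h = (1 / h) *\<^sub>R (superop_exp M h Y - Y)" for h
  have q: "(q \<longlongrightarrow> M Y) (at_right 0)"
    unfolding q_def by (rule superop_exp_quotient_tendsto[OF M])
  have ev: "\<forall>\<^sub>F h in at_right 0. 0 < (h :: real)"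
    by (simp add: eventually_at_right_less)
  have "closed {X :: 'a operator. hermitian X}"
    by (rule closed_subspace[OF subspace_hermitian])
  moreover have "\<forall>\<^sub>F h in at_right 0. q h \<in> {X. hermitian X}"
    using ev by eventually_elim (simp add: q_def Y positive_hermitian_contraction[OF pos Y])
  ultimately have "M Y \<in> {X. hermitian X}"
    using Lim_in_closed_set q trivial_limit_at_right_real by blast
  then show "hermitian (M Y)"
    by simp
  assume "sign_operator Q Y"
  then have Q: "norming Q Y"
    by (simp add: sign_operator_def)
  have "((\<lambda>h. Re (trace (Q ** q h))) \<longlongrightarrow> Re (trace (Q ** M Y))) (at_right 0)"
    by (rule bounded_linear.tendsto[OF bounded_linear_operator[OF linear_Re_trace] q])
  moreover have "\<forall>\<^sub>F h in at_right 0. Re (trace (Q ** q h)) \<le> 0"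
    using ev
  proof eventually_elim
    case (elim h)
    have "Re (trace (Q ** superop_exp M h Y)) \<le> trace_norm (superop_exp M h Y)"
      using Q positive_hermitian_contraction(1)[OF pos Y] elim by (simp add: norming_def)
    also have "\<dots> \<le> Re (trace (Q ** Y))"
      using Q positive_hermitian_contraction(2)[OF pos Y, of h] elim by (simp add: norming_def)
    finally show ?case
      using elim by (simp add: q_def matrix_mult_scaleR matrix_mult_diff trace_scaleR trace_sub
          divide_nonpos_pos)
  qed
  ultimately show "Re (trace (Q ** M Y)) \<le> 0"
    by (rule tendsto_upperbound) simp
qed

lemma hermitian_superop_exp:
  assumes M: "linear M" and herm: "\<And>Y. hermitian Y \<Longrightarrow> hermitian (M Y)" and X: "hermitian X"
  shows "hermitian (superop_exp M t X)"
proof -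
  have "hermitian ((M ^^ k) X)" for k
    by (induction k) (simp_all add: herm X)
  then show ?thesis
    unfolding superop_exp_linear_image[OF M linear_dagger] by (simp add: superop_exp_def)
qed

text \<open>The mean value theorem for \<open>Re (trace (Q ** Y s))\<close>, with \<open>Q\<close> the sign of the later endpoint,
  bounds the growth of the trace norm over a short interval by an arbitrarily small multiple of its length.\<close>

lemma dissipative_contraction:
  assumes M: "linear M" and dis: "dissipative M" and X: "hermitian X" and "0 \<le> t"
  shows "trace_norm (superop_exp M t X) \<le> trace_norm X"
proof (cases "t = 0")
  case False
  with \<open>0 \<le> t\<close> have t: "0 < t"
    by simp
  define Y where "Y s = superop_exp M s X" for s
  have Y_herm: "hermitian (Y s)" for s
    using hermitian_superop_exp[OF M _ X] dis by (auto simp: Y_def dissipative_def)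
  have MY_herm: "hermitian (M (Y s))" for s
    using Y_herm dis by (auto simp: dissipative_def)
  have Y_deriv: "(Y has_vector_derivative M (Y s)) (at s)" for s
    using superop_exp_derivative[OF M, of X s UNIV] by (simp add: Y_def[abs_def] superop_exp_commute[OF M])
  have "continuous_on {0..t} Y"
    using Y_deriv by (meson continuous_on_vector_derivative has_vector_derivative_at_within)
  then have "continuous_on {0..t} (\<lambda>s. M (Y s))"
    by (rule linear_continuous_on_compose[OF _ M])
  then have uc: "uniformly_continuous_on {0..t} (\<lambda>s. M (Y s))"
    by (simp add: compact_uniformly_continuous)
  have "trace_norm (Y t) \<le> trace_norm X + t * e" if "0 < e" for e
  proof -
    \<comment> \<open>Uniform continuity is measured in the Hilbert-Schmidt norm; passing to the
      trace norm costs the factor \<open>CARD('a)\<close>.\<close>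
    define c where "c = e / CARD('a)"
    have "0 < c"
      using that by (simp add: c_def)
    then obtain d where d: "0 < d" "\<And>u v. \<lbrakk>u \<in> {0..t}; v \<in> {0..t}; dist v u < d\<rbrakk> \<Longrightarrow> dist (M (Y v)) (M (Y u)) < c"
      using uc unfolding uniformly_continuous_on_def by metis
    have step: "trace_norm (Y s) - trace_norm (Y r) \<le> (s - r) * e"
      if "0 \<le> r" "r < s" "s \<le> t" "s - r < d" for r s
    proof -
      \<comment> \<open>The functional of the later endpoint is exact at \<open>Y s\<close> and at
        most the norm at \<open>Y r\<close>, so the increment of the norm is bounded by the
        increment of the functional.\<close>
      obtain Q where sQ: "sign_operator Q (Y s)"
        using sign_operator_exists[OF Y_herm] by blast
      then have Q: "norming Q (Y s)"
        by (simp add: sign_operator_def)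
      have "((\<lambda>s. Re (trace (Q ** Y s))) has_real_derivative Re (trace (Q ** M (Y u)))) (at u)" for u
        using bounded_linear.has_vector_derivative[OF bounded_linear_operator[OF linear_Re_trace] Y_deriv]
        by (simp add: has_real_derivative_iff_has_vector_derivative)
      from MVT2[OF \<open>r < s\<close> this]
      obtain u where u: "r < u" "u < s"
        "Re (trace (Q ** Y s)) - Re (trace (Q ** Y r)) = (s - r) * Re (trace (Q ** M (Y u)))"
        by blast
      have "Re (trace (Q ** M (Y u))) = Re (trace (Q ** M (Y s))) + Re (trace (Q ** (M (Y u) - M (Y s))))"
        by (simp add: matrix_mult_diff trace_sub)
      also have "\<dots> \<le> 0 + trace_norm (M (Y u) - M (Y s))"
      proof (rule add_mono)
        show "Re (trace (Q ** M (Y s))) \<le> 0"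
          using dis sQ Y_herm by (simp add: dissipative_def)
        show "Re (trace (Q ** (M (Y u) - M (Y s)))) \<le> trace_norm (M (Y u) - M (Y s))"
          using Q MY_herm by (simp add: norming_def)
      qed
      also have "\<dots> \<le> CARD('a) * norm (M (Y u) - M (Y s))"
        using trace_norm_bounds(2) by simp
      also have "\<dots> \<le> CARD('a) * c"
      proof (rule mult_left_mono)
        show "norm (M (Y u) - M (Y s)) \<le> c"
          using d(2)[of s u] that u by (simp add: dist_norm less_imp_le)
      qed simp
      also have "\<dots> = e"
        by (simp add: c_def)
      finally have "(s - r) * Re (trace (Q ** M (Y u))) \<le> (s - r) * e"
        using that by (intro mult_left_mono) auto
      moreover have "Re (trace (Q ** Y r)) \<le> trace_norm (Y r)"
        using Q Y_herm by (simp add: norming_def)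
      ultimately show ?thesis
        using u(3) Q by (simp add: norming_def)
    qed
    \<comment> \<open>\<open>n\<close> equal steps, each shorter than \<open>d\<close>; their
      increments add up to \<open>t * e\<close>.\<close>
    obtain n where n: "t / d < real n"
      using reals_Archimedean2 by blast
    then have "0 < real n"
      using t d by (meson divide_pos_pos less_trans)
    then have h: "t / n < d" "0 < t / n"
      using n t d by (simp_all add: field_simps)
    have "trace_norm (Y (k * (t / n))) \<le> trace_norm X + k * (t / n) * e" if "k \<le> n" for k :: nat
      using that
    proof (induction k)
      case (Suc k)
      have "real (Suc k) * (t / n) \<le> real n * (t / n)"
        using Suc.prems h by (intro mult_right_mono) auto
      moreover have "real (Suc k) * (t / n) = k * (t / n) + t / n"
        by (simp add: distrib_right add.commute add_divide_distrib)
      moreover have "0 \<le> k * (t / n)"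
        using h by (intro mult_nonneg_nonneg) auto
      ultimately have "trace_norm (Y (Suc k * (t / n))) - trace_norm (Y (k * (t / n))) \<le>
          (Suc k * (t / n) - k * (t / n)) * e"
        using h \<open>0 < real n\<close> by (intro step) auto
      then show ?case
        using Suc by (simp add: algebra_simps)
    qed (simp add: Y_def)
    from this[of n] \<open>0 < real n\<close> show ?thesis
      by simp
  qed
  then have *: "trace_norm (Y t) \<le> trace_norm X + e" if "0 < e" for e
    using that t by (metis divide_pos_pos nonzero_mult_div_cancel_left order_less_irrefl times_divide_eq_right)
  then show ?thesis
    unfolding Y_def by (rule field_le_epsilon)
qed simp

section \<open>The regularized incomplete Gamma function at integers\<close>

text \<open>The probability that a Poisson variable of mean \<open>z\<close> is at least
  \<open>k\<close>, which equals the Erlang distribution function g(k, z) for positive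
  \<open>k\<close>. At \<open>k = 0\<close> the sum is empty and the value 1 matches the convention
  for g(0, z).\<close>

definition poisson_tail :: "nat \<Rightarrow> real \<Rightarrow> real" where
  "poisson_tail k z = 1 - exp (- z) * (\<Sum>j<k. z ^ j / fact j)"

lemma poisson_tail_Suc: "poisson_tail (Suc k) z = poisson_tail k z - exp (- z) * z ^ k / fact k"
  by (simp add: poisson_tail_def algebra_simps)

lemma poisson_tail_Suc_0: "poisson_tail (Suc k) 0 = 0"
  unfolding poisson_tail_def by (subst sum.lessThan_Suc_shift) simp

text \<open>The derivative of a Poisson weight is a difference of neighbouring weights; the sum
  telescopes to a single term, the Erlang density.\<close>

lemma poisson_tail_derivative:
  "(poisson_tail (Suc k) has_real_derivative exp (- z) * z ^ k / fact k) (at z)"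
proof (induction k)
  case 0
  have "poisson_tail (Suc 0) = (\<lambda>z. 1 - exp (- z))"
    by (simp add: poisson_tail_def fun_eq_iff)
  then show ?case
    by (auto intro!: derivative_eq_intros)
next
  case (Suc k)
  have "((\<lambda>z. poisson_tail (Suc k) z - exp (- z) * z ^ Suc k / fact (Suc k)) has_real_derivative
      exp (- z) * z ^ k / fact k - (exp (- z) * (real (Suc k) * z ^ k) - exp (- z) * z ^ Suc k) / fact (Suc k))
      (at z)"
    by (rule derivative_eq_intros Suc refl | simp)+
  moreover have "exp (- z) * (real (Suc k) * z ^ k) / fact (Suc k) = exp (- z) * z ^ k / fact k"
    by (simp add: fact_Suc del: of_nat_Suc)
  ultimately show ?case
    by (simp add: poisson_tail_Suc[of "Suc k", abs_def] diff_divide_distrib)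
qed

lemma poisson_tail_continuous: "continuous_on S (poisson_tail k)"
  unfolding poisson_tail_def[abs_def] by (intro continuous_intros) simp

lemma poisson_tail_nonneg:
  assumes "0 \<le> z"
  shows "0 \<le> poisson_tail k z"
proof (cases k)
  case (Suc m)
  have "poisson_tail (Suc m) 0 \<le> poisson_tail (Suc m) z"
  proof (rule DERIV_nonneg_imp_nondecreasing[OF assms])
    fix x :: real assume "0 \<le> x"
    then show "\<exists>y. (poisson_tail (Suc m) has_real_derivative y) (at x) \<and> 0 \<le> y"
      using poisson_tail_derivative[of m x] by force
  qed
  then show ?thesis
    by (simp add: Suc poisson_tail_Suc_0)
qed (simp add: poisson_tail_def)

lemma poisson_tail_le_1: "0 \<le> z \<Longrightarrow> poisson_tail k z \<le> 1"
  by (simp add: poisson_tail_def sum_nonneg)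

lemma reg_lower_gamma_nat:
  assumes "0 \<le> z"
  shows "reg_lower_gamma (real k) z = poisson_tail k z"
proof (cases k)
  case (Suc m)
  have "((\<lambda>x. exp (- x) * x ^ m / fact m) has_integral poisson_tail (Suc m) z - poisson_tail (Suc m) 0) {0..z}"
    using assms poisson_tail_derivative[of m]
    by (intro fundamental_theorem_of_calculus)
       (auto simp: has_real_derivative_iff_has_vector_derivative intro: has_vector_derivative_at_within)
  then have "((\<lambda>x. exp (- x) * x ^ m / fact m) has_integral poisson_tail (Suc m) z) {0..z}"
    by (simp add: poisson_tail_Suc_0)
  from has_integral_mult_right[OF this, of "fact m"]
  have "((\<lambda>x. exp (- x) * x ^ m) has_integral fact m * poisson_tail (Suc m) z) {0..z}"
    by simp
  \<comment> \<open>The point 0 is removed because \<open>0 powr 0\<close> is 0 while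
    \<open>0 ^ 0\<close> is 1, so for \<open>m = 0\<close> the two integrands differ there.\<close>
  then have "((\<lambda>x. x powr (real (Suc m) - 1) * exp (- x)) has_integral fact m * poisson_tail (Suc m) z) {0..z}"
    by (rule has_integral_spike_finite[of "{0}", rotated 2]) (auto simp: powr_realpow)
  then have "integral {0..z} (\<lambda>x. x powr (real (Suc m) - 1) * exp (- x)) = fact m * poisson_tail (Suc m) z"
    by (rule integral_unique)
  moreover have "Gamma (real (Suc m)) = fact m"
    using Gamma_fact[of m, where 'a = real] by (simp add: add.commute)
  ultimately show ?thesis
    by (simp add: reg_lower_gamma_def Suc del: of_nat_Suc)
qed (simp add: reg_lower_gamma_def poisson_tail_def)

lemma F_fun_eq: "0 \<le> z \<Longrightarrow> F_fun l z = z * poisson_tail l z - real l * poisson_tail (Suc l) z"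
  using reg_lower_gamma_nat[of z "Suc l"] by (simp add: F_fun_def reg_lower_gamma_nat add.commute)

lemma F_fun_le:
  assumes "0 \<le> z"
  shows "F_fun l z \<le> z"
proof -
  have "z * poisson_tail l z \<le> z"
    using assms poisson_tail_le_1 mult_left_le by blast
  moreover have "0 \<le> real l * poisson_tail (Suc l) z"
    using poisson_tail_nonneg[OF assms] by simp
  ultimately show ?thesis
    using F_fun_eq[OF assms, of l] by linarith
qed

text \<open>In the derivative of \<open>H\<close> the two density terms cancel: \<open>z\<close>
  times the density of order \<open>l\<close> is \<open>l\<close> times the density of order
  \<open>l + 1\<close>.\<close>

lemma integral_poisson_tail:
  assumes "0 < \<kappa>" "0 \<le> t"
  shows "integral {0..t} (\<lambda>s. poisson_tail l (\<kappa> * s)) = F_fun l (\<kappa> * t) / \<kappa>"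
proof -
  define H where "H z = z * poisson_tail l z - real l * poisson_tail (Suc l) z" for z
  have H: "(H has_real_derivative poisson_tail l z) (at z)" for z
  proof (cases l)
    case 0
    then show ?thesis
      by (simp add: H_def[abs_def] poisson_tail_def)
  next
    case (Suc m)
    have "(H has_real_derivative poisson_tail (Suc m) z + exp (- z) * z ^ m / fact m * z
        - real (Suc m) * (exp (- z) * z ^ Suc m / fact (Suc m))) (at z)"
      unfolding H_def[abs_def] Suc
      by (rule derivative_eq_intros poisson_tail_derivative refl | simp)+
    moreover have "real (Suc m) * (exp (- z) * z ^ Suc m / fact (Suc m)) = exp (- z) * z ^ m / fact m * z"
      by (simp add: fact_Suc mult_ac del: of_nat_Suc)
    ultimately show ?thesis
      by (simp add: Suc)
  qed
  have "((\<lambda>s. H (\<kappa> * s) / \<kappa>) has_real_derivative poisson_tail l (\<kappa> * s)) (at s within {0..t})" for s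
  proof -
    have "((\<lambda>s. H (\<kappa> * s)) has_real_derivative poisson_tail l (\<kappa> * s) * \<kappa>) (at s within {0..t})"
      using DERIV_chain2[of H _ "\<lambda>s. \<kappa> * s" s \<kappa> "{0..t}", OF H] by (auto intro!: derivative_eq_intros)
    from DERIV_cdivide[OF this, of \<kappa>] show ?thesis
      using assms by simp
  qed
  then have "((\<lambda>s. poisson_tail l (\<kappa> * s)) has_integral H (\<kappa> * t) / \<kappa> - H (\<kappa> * 0) / \<kappa>) {0..t}"
    using assms by (intro fundamental_theorem_of_calculus)
      (simp_all add: has_real_derivative_iff_has_vector_derivative)
  moreover have "H 0 = 0"
    by (simp add: H_def poisson_tail_Suc_0)
  ultimately have "integral {0..t} (\<lambda>s. poisson_tail l (\<kappa> * s)) = H (\<kappa> * t) / \<kappa>"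
    by (simp add: integral_unique)
  then show ?thesis
    using assms by (simp add: F_fun_eq H_def)
qed

lemma F_fun_nonneg:
  assumes "0 \<le> z"
  shows "0 \<le> F_fun l z"
proof -
  have "0 \<le> integral {0..z} (\<lambda>s. poisson_tail l (1 * s))"
    by (rule integral_nonneg)
       (auto intro!: integrable_continuous_real poisson_tail_continuous poisson_tail_nonneg)
  then show ?thesis
    using integral_poisson_tail[of 1 z l] assms by simp
qed

text \<open>Adding one independent exponential waiting time of rate \<kappa> turns the distribution
  function of order \<open>k\<close> into that of order \<open>k + 1\<close>. The antiderivative is
  the new distribution function times the exponential factor.\<close>

lemma integral_exp_poisson_tail:
  assumes "0 < \<kappa>" "0 \<le> t"
  shows "integral {0..t} (\<lambda>s. \<kappa> * exp (- \<kappa> * (t - s)) * poisson_tail k (\<kappa> * s)) = poisson_tail (Suc k) (\<kappa> * t)"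
proof -
  have "((\<lambda>s. exp (- \<kappa> * (t - s)) * poisson_tail (Suc k) (\<kappa> * s)) has_real_derivative
      \<kappa> * exp (- \<kappa> * (t - s)) * poisson_tail k (\<kappa> * s)) (at s within {0..t})" for s
  proof -
    have 1: "((\<lambda>s. poisson_tail (Suc k) (\<kappa> * s)) has_real_derivative
        exp (- (\<kappa> * s)) * (\<kappa> * s) ^ k / fact k * \<kappa>) (at s within {0..t})"
      using DERIV_chain2[of "poisson_tail (Suc k)" _ "\<lambda>s. \<kappa> * s" s \<kappa> "{0..t}",
          OF poisson_tail_derivative]
      by (auto intro!: derivative_eq_intros)
    have 2: "((\<lambda>s. exp (- \<kappa> * (t - s))) has_real_derivative exp (- \<kappa> * (t - s)) * \<kappa>) (at s within {0..t})"
      by (auto intro!: derivative_eq_intros)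
    show ?thesis
      using DERIV_mult[OF 2 1] by (simp add: poisson_tail_Suc algebra_simps)
  qed
  then have "((\<lambda>s. \<kappa> * exp (- \<kappa> * (t - s)) * poisson_tail k (\<kappa> * s)) has_integral
      exp (- \<kappa> * (t - t)) * poisson_tail (Suc k) (\<kappa> * t) - exp (- \<kappa> * (t - 0)) * poisson_tail (Suc k) (\<kappa> * 0)) {0..t}"
    using assms by (intro fundamental_theorem_of_calculus)
      (simp_all add: has_real_derivative_iff_has_vector_derivative)
  then show ?thesis
    by (simp add: integral_unique poisson_tail_Suc_0)
qed

section \<open>The recovery channel\<close>

lemma psd_trace_norm: "psd A \<Longrightarrow> trace_norm A \<le> Re (trace A)"
  using trace_norm_diff_le[OF _ psd_0, of A] by simp

lemma psd_trace_real: "psd A \<Longrightarrow> trace A = complex_of_real (Re (trace A))"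
  by (rule hermitian_trace_real[OF psd_hermitian])

lemma psd_eq_scaled_density:
  assumes "psd A" "A \<noteq> 0"
  obtains \<rho> where "\<rho> \<in> density_ops" "A = Re (trace A) *\<^sub>R \<rho>" "0 < Re (trace A)"
proof -
  have pos: "0 < Re (trace A)"
    using trace_norm_pos[OF assms(2)] psd_trace_norm[OF assms(1)] by linarith
  define \<rho> where "\<rho> = (1 / Re (trace A)) *\<^sub>R A"
  have "trace \<rho> = (1 / Re (trace A)) *\<^sub>R complex_of_real (Re (trace A))"
    using psd_trace_real[OF assms(1)] by (simp add: \<rho>_def trace_scaleR)
  then have "trace \<rho> = 1"
    using pos by (simp add: complex_eq_iff)
  then have "\<rho> \<in> density_ops"
    using assms(1) pos by (simp add: density_ops_def \<rho>_def psd_scaleR)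
  with pos that show thesis
    by (simp add: \<rho>_def)
qed

text \<open>The convergence condition speaks of density operators, whereas
  \<open>superop_limit\<close> is meaningful only where the limit exists. Scaling, Jordan splitting
  and the Hermitian decomposition extend convergence to all operators.\<close>

lemma superop_limit_tendsto:
  assumes exp: "\<And>t. 0 \<le> t \<Longrightarrow> clinear_superop (superop_exp M t)"
    and conv: "convergence_condition M \<kappa> chi"
  shows "((\<lambda>t. superop_exp M t X) \<longlongrightarrow> superop_limit M X) at_top"
proof -
  define conv where "conv X \<longleftrightarrow> (\<exists>Y. ((\<lambda>t. superop_exp M t X) \<longlongrightarrow> Y) at_top)" for X
  have ev: "\<forall>\<^sub>F t in at_top. 0 \<le> (t :: real)"
    by (rule eventually_ge_at_top)
  have add: "conv (X + Y)" if c: "conv X" "conv Y" for X Y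
  proof -
    obtain X' Y' where "((\<lambda>t. superop_exp M t X) \<longlongrightarrow> X') at_top" "((\<lambda>t. superop_exp M t Y) \<longlongrightarrow> Y') at_top"
      using c unfolding conv_def by blast
    then have "((\<lambda>t. superop_exp M t X + superop_exp M t Y) \<longlongrightarrow> X' + Y') at_top"
      by (rule tendsto_add)
    moreover have "\<forall>\<^sub>F t in at_top. superop_exp M t X + superop_exp M t Y = superop_exp M t (X + Y)"
      using ev by eventually_elim (use exp in \<open>simp add: clinear_superop_def\<close>)
    ultimately show ?thesis
      unfolding conv_def by (blast intro: Lim_transform_eventually)
  qed
  have scale: "conv (c \<cdot>\<^sub>C X)" if cX: "conv X" for c X
  proof -
    obtain X' where "((\<lambda>t. superop_exp M t X) \<longlongrightarrow> X') at_top"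
      using cX unfolding conv_def by blast
    then have "((\<lambda>t. c \<cdot>\<^sub>C superop_exp M t X) \<longlongrightarrow> c \<cdot>\<^sub>C X') at_top"
      by (rule bounded_linear.tendsto[OF bounded_linear_operator[OF linear_cscale]])
    moreover have "\<forall>\<^sub>F t in at_top. c \<cdot>\<^sub>C superop_exp M t X = superop_exp M t (c \<cdot>\<^sub>C X)"
      using ev by eventually_elim (use exp in \<open>simp add: clinear_superop_def\<close>)
    ultimately show ?thesis
      unfolding conv_def by (blast intro: Lim_transform_eventually)
  qed
  have psd: "conv A" if A: "psd A" for A
  proof (cases "A = 0")
    case True
    have "\<forall>\<^sub>F t in at_top. 0 = superop_exp M t A"
      using ev by eventually_elim (use exp in \<open>simp add: True linear_0[OF clinear_linear]\<close>)
    from Lim_transform_eventually[OF tendsto_const this] show ?thesis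
      unfolding conv_def by blast
  next
    case False
    obtain \<rho> where \<rho>: "\<rho> \<in> density_ops" "A = Re (trace A) *\<^sub>R \<rho>"
      using psd_eq_scaled_density[OF A False] by blast
    then have "conv \<rho>"
      using conv by (auto simp: convergence_condition_def conv_def)
    then have "conv (complex_of_real (Re (trace A)) \<cdot>\<^sub>C \<rho>)"
      by (rule scale)
    then show ?thesis
      by (simp only: cscale_of_real flip: \<rho>(2))
  qed
  have herm: "conv H" if H: "hermitian H" for H
  proof -
    obtain A B where AB: "psd A" "psd B" "H = A - B"
      using jordan_decomposition[OF H] by blast
    have "H = A + (- 1) \<cdot>\<^sub>C B"
      by (simp add: AB(3) vec_eq_iff cscale_def)
    then show ?thesis
      using add[OF psd[OF AB(1)] scale[OF psd[OF AB(2)]]] by metis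
  qed
  obtain H K where "hermitian H" "hermitian K" "X = H + \<i> \<cdot>\<^sub>C K"
    by (rule hermitian_decomposition)
  then have "conv X"
    using add herm scale by simp
  then show ?thesis
    unfolding conv_def superop_limit_def using tendsto_Lim[OF trivial_limit_at_top_linorder] by metis
qed

lemma closed_psd: "closed {A :: 'n::finite operator. psd A}"
proof -
  have "closed {A :: 'n operator. hermitian A}"
    by (rule closed_subspace[OF subspace_hermitian])
  moreover have "closed {A :: 'n operator. 0 \<le> Re (cinner v (A *v v))}" for v
  proof (rule closed_Collect_le)
    show "continuous_on UNIV (\<lambda>A :: 'n operator. Re (cinner v (A *v v)))"
      unfolding trace_ketbra_mult[symmetric] by (rule linear_continuous_on[OF bounded_linear_operator[OF linear_Re_trace]])
  qed simp
  moreover have "{A :: 'n operator. psd A} = {A. hermitian A} \<inter> (\<Inter>v. {A. 0 \<le> Re (cinner v (A *v v))})"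
    by (auto simp: psd_iff)
  ultimately show ?thesis
    by (simp add: closed_INT closed_Int)
qed

lemma superop_limit_positive_trace_preserving:
  assumes pos: "\<And>t. 0 \<le> t \<Longrightarrow> positive_trace_preserving (superop_exp M t)"
    and lim: "\<And>X. ((\<lambda>t. superop_exp M t X) \<longlongrightarrow> superop_limit M X) at_top"
  shows "positive_trace_preserving (superop_limit M)"
proof -
  have ev: "\<forall>\<^sub>F t in at_top. 0 \<le> (t :: real)"
    by (rule eventually_ge_at_top)
  have unique: "superop_limit M X = Y"
    if "((\<lambda>t. f t) \<longlongrightarrow> Y) at_top" "\<And>t. 0 \<le> t \<Longrightarrow> f t = superop_exp M t X" for X Y f
  proof -
    have "\<forall>\<^sub>F t in at_top. f t = superop_exp M t X"
      using ev by eventually_elim (rule that(2))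
    then have "((\<lambda>t. superop_exp M t X) \<longlongrightarrow> Y) at_top"
      by (rule Lim_transform_eventually[OF that(1)])
    then show ?thesis
      using tendsto_unique[OF trivial_limit_at_top_linorder lim] by blast
  qed
  have "superop_limit M (X + Y) = superop_limit M X + superop_limit M Y" for X Y
    by (rule unique[OF tendsto_add[OF lim lim]])
       (use pos in \<open>simp add: positive_trace_preserving_def clinear_superop_def\<close>)
  moreover have "superop_limit M (c \<cdot>\<^sub>C X) = c \<cdot>\<^sub>C superop_limit M X" for c X
    by (rule unique[OF bounded_linear.tendsto[OF bounded_linear_operator[OF linear_cscale] lim]])
       (use pos in \<open>simp add: positive_trace_preserving_def clinear_superop_def\<close>)
  moreover have "psd (superop_limit M X)" if "psd X" for X
  proof -
    have "\<forall>\<^sub>F t in at_top. superop_exp M t X \<in> {A. psd A}"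
      using ev by eventually_elim (use pos that in \<open>simp add: positive_trace_preserving_def\<close>)
    from Lim_in_closed_set[OF closed_psd this trivial_limit_at_top_linorder lim] show ?thesis
      by simp
  qed
  moreover have "trace (superop_limit M X) = trace X" for X
  proof -
    have "((\<lambda>t. trace (superop_exp M t X)) \<longlongrightarrow> trace (superop_limit M X)) at_top"
      by (rule bounded_linear.tendsto[OF bounded_linear_operator[OF linear_trace] lim])
    moreover have "\<forall>\<^sub>F t in at_top. trace (superop_exp M t X) = trace X"
      using ev by eventually_elim (use pos in \<open>simp add: positive_trace_preserving_def\<close>)
    ultimately have "((\<lambda>t. trace X) \<longlongrightarrow> trace (superop_limit M X)) (at_top :: real filter)"
      by (rule Lim_transform_eventually)
    then show ?thesis
      using tendsto_unique[OF trivial_limit_at_top_linorder _ tendsto_const] by blast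
  qed
  ultimately show ?thesis
    by (simp add: positive_trace_preserving_def clinear_superop_def)
qed

text \<open>Each Jordan part is a multiple of a state and approaches its own limit at the assumed
  rate; the two limits cancel since \<open>superop_limit M Y = 0\<close>. The traces of the parts
  add up to the trace norm of \<open>Y\<close>, so no factor is lost.\<close>

lemma superop_exp_decay:
  assumes pos: "\<And>t. 0 \<le> t \<Longrightarrow> positive_trace_preserving (superop_exp M t)"
    and M: "linear M" and conv: "convergence_condition M \<kappa> chi"
    and Y: "hermitian Y" "superop_limit M Y = 0" and "0 \<le> t"
  shows "trace_norm (superop_exp M t Y) \<le> chi * exp (- \<kappa> * t) * trace_norm Y"
proof -
  have clin: "clinear_superop (superop_exp M t)" if "0 \<le> t" for t
    using pos[OF that] by (simp add: positive_trace_preserving_def)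
  note lim = superop_limit_tendsto[OF clin conv]
  note R = superop_limit_positive_trace_preserving[OF pos lim]
  have R_lin: "linear (superop_limit M)"
    using R clinear_linear by (auto simp: positive_trace_preserving_def)
  have herm: "hermitian (superop_exp M s A - superop_limit M A)" if "psd A" "0 \<le> s" for A s
    using that pos R by (simp add: positive_trace_preserving_def psd_hermitian)
  have psd: "trace_norm (superop_exp M s A - superop_limit M A) \<le> chi * exp (- \<kappa> * s) * Re (trace A)"
    if A: "psd A" "0 < s" for A s
  proof (cases "A = 0")
    case True
    have "superop_exp M s A = 0" "superop_limit M A = 0"
      using linear_0[OF linear_superop_exp[OF M]] linear_0[OF R_lin] by (simp_all add: True)
    then show ?thesis
      using trace_norm_bounds(2)[of "0 :: 'a operator"] True by (simp add: trace_def)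
  next
    case False
    obtain \<rho> where \<rho>: "\<rho> \<in> density_ops" "A = Re (trace A) *\<^sub>R \<rho>" "0 < Re (trace A)"
      using psd_eq_scaled_density[OF A(1) False] by blast
    define a where "a = Re (trace A)"
    obtain \<sigma> where \<sigma>: "((\<lambda>t. superop_exp M t \<rho>) \<longlongrightarrow> \<sigma>) at_top"
      "trace_norm (superop_exp M s \<rho> - \<sigma>) \<le> chi * exp (- \<kappa> * s)"
      using conv \<rho>(1) \<open>0 < s\<close> unfolding convergence_condition_def by blast
    have "superop_limit M \<rho> = \<sigma>"
      using tendsto_unique[OF trivial_limit_at_top_linorder lim \<sigma>(1)] .
    moreover have "psd \<rho>"
      using \<rho>(1) by (simp add: density_ops_def)
    moreover have "superop_exp M s A - superop_limit M A = a *\<^sub>R (superop_exp M s \<rho> - superop_limit M \<rho>)"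
      using \<rho>(2) by (metis a_def linear_scale[OF linear_superop_exp[OF M]] linear_scale[OF R_lin] scaleR_diff_right)
    ultimately have "trace_norm (superop_exp M s A - superop_limit M A)
        \<le> a * trace_norm (superop_exp M s \<rho> - \<sigma>)"
      using trace_norm_scaleR_le[OF herm, of \<rho> s a] \<rho>(3) A by (simp add: a_def)
    also have "\<dots> \<le> a * (chi * exp (- \<kappa> * s))"
      using \<rho>(3) \<sigma>(2) by (intro mult_left_mono) (simp_all add: a_def)
    finally show ?thesis
      by (simp add: a_def mult_ac)
  qed
  have main: "trace_norm (superop_exp M s Y) \<le> chi * exp (- \<kappa> * s) * trace_norm Y" if s: "0 < s" for s
  proof -
    obtain A B where AB: "psd A" "psd B" "Y = A - B" "trace_norm Y = Re (trace (A + B))"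
      using jordan_decomposition[OF Y(1)] by blast
    have "superop_exp M s Y = (superop_exp M s A - superop_limit M A) + - (superop_exp M s B - superop_limit M B)"
      using Y(2) by (simp add: AB(3) linear_diff[OF linear_superop_exp[OF M]] linear_diff[OF R_lin])
    moreover have "hermitian (- (superop_exp M s B - superop_limit M B))"
      using herm[OF AB(2), of s] s dagger_simps(3)[of 0 "superop_exp M s B - superop_limit M B"] by simp
    ultimately have "trace_norm (superop_exp M s Y) \<le> trace_norm (superop_exp M s A - superop_limit M A)
        + trace_norm (superop_exp M s B - superop_limit M B)"
      using trace_norm_triangle[OF herm[OF AB(1)], of s] s by (metis trace_norm_minus less_imp_le)
    also have "\<dots> \<le> chi * exp (- \<kappa> * s) * Re (trace A) + chi * exp (- \<kappa> * s) * Re (trace B)"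
      by (intro add_mono psd AB s)
    finally show ?thesis
      by (simp add: AB(4) trace_add distrib_left)
  qed
  show ?thesis
  proof (cases "t = 0")
    \<comment> \<open>The convergence condition covers \<open>t > 0\<close> only. Time zero occurs
      at the end of the Dyson integrals and is reached by letting \<open>s\<close> tend to 0 from
      the right in a norming functional.\<close>
    case True
    obtain Q where Q: "norming Q Y"
      using norming_exists[OF Y(1)] by blast
    have "continuous_on UNIV (\<lambda>s. Re (trace (Q ** superop_exp M s Y)))"
      by (intro linear_continuous_on_compose[OF _ linear_Re_trace] superop_exp_continuous_on[OF M]
          continuous_intros)
    then have "((\<lambda>s. Re (trace (Q ** superop_exp M s Y))) \<longlongrightarrow> Re (trace (Q ** superop_exp M 0 Y))) (at_right 0)"
      using tendsto_within_subset[OF _ subset_UNIV] unfolding continuous_on_def by blast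
    moreover have "((\<lambda>s. chi * exp (- \<kappa> * s) * trace_norm Y) \<longlongrightarrow> chi * exp (- \<kappa> * 0) * trace_norm Y) (at_right 0)"
      by (intro tendsto_intros)
    moreover have "\<forall>\<^sub>F s in at_right 0. Re (trace (Q ** superop_exp M s Y)) \<le> chi * exp (- \<kappa> * s) * trace_norm Y"
      using eventually_at_right_less[of "0 :: real"]
    proof eventually_elim
      case (elim s)
      have "Re (trace (Q ** superop_exp M s Y)) \<le> trace_norm (superop_exp M s Y)"
        using Q positive_hermitian_contraction(1)[OF pos Y(1), of s] elim by (simp add: norming_def)
      with main[OF elim] show ?case
        by linarith
    qed
    ultimately have "Re (trace (Q ** superop_exp M 0 Y)) \<le> chi * exp (- \<kappa> * 0) * trace_norm Y"
      by (intro tendsto_le[OF trivial_limit_at_right_real])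
    with Q True show ?thesis
      by (simp add: norming_def)
  qed (use main \<open>0 \<le> t\<close> in simp)
qed

section \<open>Operators supported in a subspace\<close>

lemma vec_subspace_subspace: "vec.subspace S \<Longrightarrow> subspace S" for S :: "(complex ^ 'n) set"
  unfolding subspace_def vec.subspace_def by (simp flip: scale_of_real)

text \<open>For Hermitian \<open>X\<close>, a vector \<open>z\<close> orthogonal to \<open>S\<close>
  satisfies \<open>cinner (X *v z) (X *v z) = cinner z (X *v (X *v z)) = 0\<close>, so it lies in
  the kernel and is orthogonal to the support. Thus a range condition alone makes an operator
  admissible in \<open>restricted_norm\<close>.\<close>

lemma op_support_subset:
  assumes X: "hermitian X" and S: "vec.subspace S" and range: "op_range X \<subseteq> S"
  shows "op_support X \<subseteq> S"
proof
  fix v assume v: "v \<in> op_support X"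
  have sub: "subspace S"
    by (rule vec_subspace_subspace[OF S])
  then obtain y z where yz: "y \<in> S" "\<And>w. w \<in> S \<Longrightarrow> orthogonal z w" "v = y + z"
    using orthogonal_subspace_decomp_exists[of S v] span_eq_iff by metis
  have orth: "cinner z w = 0" if "w \<in> S" for w
  proof -
    \<comment> \<open>The decomposition uses the real inner product; closure of \<open>S\<close>
      under multiplication by \<i> adds the imaginary part.\<close>
    have "\<i> *s w \<in> S"
      using S that by (simp add: vec.subspace_def)
    then have "Re (cinner z w) = 0" "Re (cinner z (\<i> *s w)) = 0"
      using yz(2) that by (simp_all add: Re_cinner orthogonal_def)
    then show ?thesis
      by (simp add: cinner_scale_right complex_eq_iff)
  qed
  have "X *v (X *v z) \<in> S"
    using range by (auto simp: op_range_def)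
  then have "cinner (X *v z) (X *v z) = 0"
    using orth cinner_dagger[of z X "X *v z"] X by simp
  then have "X *v z = 0"
    by (simp add: cinner_self)
  then have "cinner z v = 0"
    using v by (simp add: op_support_def)
  then have "z = 0"
    by (simp add: yz(3) cinner_add_right orth[OF yz(1)] cinner_self)
  with yz show "v \<in> S"
    by simp
qed

lemma op_range_ketbra: "vec.subspace S \<Longrightarrow> \<psi> \<in> S \<Longrightarrow> op_range (ketbra \<psi>) \<subseteq> S"
  by (auto simp: op_range_def ketbra_vector vec.subspace_def)

lemma ketbra_density: "norm \<psi> = 1 \<Longrightarrow> ketbra \<psi> \<in> density_ops"
  by (simp add: density_ops_def psd_ketbra trace_ketbra)

lemma ketbra_code_density:
  "vec.subspace C \<Longrightarrow> \<psi> \<in> C \<Longrightarrow> norm \<psi> = 1 \<Longrightarrow> ketbra \<psi> \<in> code_density_ops C"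
  using op_support_subset[OF hermitian_ketbra _ op_range_ketbra]
  by (auto simp: code_density_ops_def ketbra_density)

text \<open>A real supremum bounds the elements of its set only if the set is bounded above; two
  comparisons with the Hilbert-Schmidt norm give a crude bound.\<close>

lemma restricted_norm_bdd:
  fixes M :: "'n::finite superoperator"
  assumes "linear M"
  shows "bdd_above ((\<lambda>X. trace_norm (M X) / trace_norm X) ` {X. X \<noteq> 0 \<and> op_range X \<subseteq> S \<and> op_support X \<subseteq> S})"
proof -
  obtain B where B: "0 < B" "\<And>X. norm (M X) \<le> B * norm X"
    using linear_bounded_pos[OF assms] by blast
  have "trace_norm (M X) / trace_norm X \<le> CARD('n) * B" if "X \<noteq> 0" for X
  proof -
    have "trace_norm (M X) \<le> CARD('n) * norm (M X)"
      by (rule trace_norm_bounds)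
    also have "\<dots> \<le> CARD('n) * (B * norm X)"
      by (intro mult_left_mono B) simp
    also have "\<dots> \<le> CARD('n) * (B * trace_norm X)"
      using B trace_norm_bounds(1) by (intro mult_left_mono) auto
    finally show ?thesis
      using trace_norm_pos[OF that] by (simp add: divide_le_eq mult_ac)
  qed
  then show ?thesis
    by (intro bdd_aboveI2) auto
qed

lemma restricted_norm_bound:
  fixes M :: "'n::finite superoperator"
  assumes M: "linear M" and S: "vec.subspace S" and X: "hermitian X" "op_range X \<subseteq> S"
  shows "trace_norm (M X) \<le> restricted_norm S M * trace_norm X"
proof (cases "X = 0")
  case True
  have "trace_norm (0 :: 'n operator) = 0"
    using trace_norm_bounds(2)[of "0 :: 'n operator"] trace_norm_nonneg[of "0 :: 'n operator"] by simp
  then show ?thesis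
    by (simp add: True linear_0[OF M])
next
  case False
  then have "trace_norm (M X) / trace_norm X \<le> restricted_norm S M"
    unfolding restricted_norm_def
    by (intro cSUP_upper restricted_norm_bdd[OF M]) (simp add: X op_support_subset[OF X(1) S X(2)])
  then show ?thesis
    using trace_norm_pos[OF False] by (simp add: divide_le_eq)
qed

lemma restricted_norm_nonneg:
  assumes M: "linear M" and S: "vec.subspace S" and \<psi>: "\<psi> \<in> S" "norm \<psi> = 1"
  shows "0 \<le> restricted_norm S M"
proof -
  have "0 \<le> restricted_norm S M * trace_norm (ketbra \<psi>)"
    using restricted_norm_bound[OF M S hermitian_ketbra op_range_ketbra[OF S \<psi>(1)]] trace_norm_nonneg
    by (rule order_trans[rotated])
  moreover have "0 < trace_norm (ketbra \<psi>)"
    using norm_ketbra[of \<psi>] \<psi> by (intro trace_norm_pos) auto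
  ultimately show ?thesis
    by (simp add: zero_le_mult_iff)
qed

section \<open>The Dyson expansion\<close>

text \<open>The interaction picture: with the free evolution outside, the integrand does not involve
  \<open>t\<close>, and differentiation needs only the product rule and the fundamental theorem. The
  price is evolution to negative times, which \<open>dyson_term_integral\<close> removes before
  positivity or decay is used.\<close>

primrec dyson_term ::
    "'n::finite superoperator \<Rightarrow> 'n superoperator \<Rightarrow> 'n operator \<Rightarrow> nat \<Rightarrow> real \<Rightarrow> 'n operator" where
  "dyson_term K M \<rho> 0 = (\<lambda>t. superop_exp K t \<rho>)"
| "dyson_term K M \<rho> (Suc k) =
     (\<lambda>t. superop_exp K t (integral {0..t} (\<lambda>s. superop_exp K (- s) (M (dyson_term K M \<rho> k s)))))"

context
  fixes K M :: "'n::finite superoperator"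
  assumes K: "linear K" and M: "linear M"
begin

lemma dyson_term_continuous: "continuous_on {0..T} (dyson_term K M \<rho> k)"
proof (induction k)
  case 0
  show ?case
    by (auto intro!: superop_exp_continuous_on[OF K] continuous_intros)
next
  case (Suc k)
  have "continuous_on {0..T} (\<lambda>s. superop_exp K (- s) (M (dyson_term K M \<rho> k s)))"
    by (intro superop_exp_continuous_on[OF K] linear_continuous_on_compose[OF Suc M] continuous_intros)
  then show ?case
    by (auto intro!: superop_exp_continuous_on[OF K] continuous_intros indefinite_integral_continuous_1
        integrable_continuous_real)
qed

lemma dyson_term_derivative:
  assumes s: "s \<in> {0..T}"
  shows "(dyson_term K M \<rho> (Suc k) has_vector_derivative
     K (dyson_term K M \<rho> (Suc k) s) + M (dyson_term K M \<rho> k s)) (at s within {0..T})"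
proof -
  let ?f = "\<lambda>s. superop_exp K (- s) (M (dyson_term K M \<rho> k s))"
  have "continuous_on {0..T} ?f"
    by (intro superop_exp_continuous_on[OF K] linear_continuous_on_compose[OF dyson_term_continuous M]
        continuous_intros)
  from integral_has_vector_derivative[OF this s]
  have "((\<lambda>t. superop_exp K t (integral {0..t} ?f)) has_vector_derivative
      superop_exp K s (1 *\<^sub>R K (integral {0..s} ?f) + ?f s)) (at s within {0..T})"
    by (intro superop_exp_product_derivative[OF K]) auto
  moreover have "superop_exp K s (1 *\<^sub>R K (integral {0..s} ?f) + ?f s) =
      K (superop_exp K s (integral {0..s} ?f)) + M (dyson_term K M \<rho> k s)"
    using superop_exp_add[OF K, of s "- s"]
    by (simp add: linear_add[OF linear_superop_exp[OF K]] superop_exp_commute[OF K])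
  ultimately show ?thesis
    by simp
qed

lemma dyson_term_integral:
  assumes "0 \<le> t"
  shows "dyson_term K M \<rho> (Suc k) t = integral {0..t} (\<lambda>s. superop_exp K (t - s) (M (dyson_term K M \<rho> k s)))"
proof -
  have "continuous_on {0..t} (\<lambda>s. superop_exp K (- s) (M (dyson_term K M \<rho> k s)))"
    by (intro superop_exp_continuous_on[OF K] linear_continuous_on_compose[OF dyson_term_continuous M]
        continuous_intros)
  then show ?thesis
    using superop_exp_add[OF K, of t "- _"]
    by (simp add: integral_linear_image[OF linear_superop_exp[OF K]] integrable_continuous_real)
qed

text \<open>The partial sum solves the perturbed equation up to the defect
  \<open>M (dyson_term K M \<rho> l s)\<close>, as the source terms of lower order telescope.
  Variation of constants for the full generator then puts the full evolution, not the free one, into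
  the remainder.\<close>

lemma dyson_remainder:
  assumes t: "0 \<le> t"
  shows "superop_exp (\<lambda>X. K X + M X) t \<rho> = (\<Sum>k\<le>l. dyson_term K M \<rho> k t)
     + integral {0..t} (\<lambda>s. superop_exp (\<lambda>X. K X + M X) (t - s) (M (dyson_term K M \<rho> l s)))"
proof -
  let ?L = "\<lambda>X. K X + M X"
  have L: "linear ?L"
    by (rule linear_compose_add[OF K M])
  have "((\<lambda>s. \<Sum>k\<le>l. dyson_term K M \<rho> k s) has_vector_derivative
      ?L (\<Sum>k\<le>l. dyson_term K M \<rho> k s) - M (dyson_term K M \<rho> l s)) (at s within {0..t})"
    if s: "s \<in> {0..t}" for s
  proof (induction l)
    case 0
    show ?case
      using superop_exp_derivative[OF K] by (simp add: superop_exp_commute[OF K])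
  next
    case (Suc l)
    from has_vector_derivative_add[OF Suc dyson_term_derivative[OF s, of \<rho> l]] show ?case
      by (simp add: linear_add[OF K] linear_add[OF M] algebra_simps del: dyson_term.simps)
  qed
  from duhamel[OF L t this]
  have "superop_exp ?L t (\<Sum>k\<le>l. dyson_term K M \<rho> k 0) = (\<Sum>k\<le>l. dyson_term K M \<rho> k t)
     + integral {0..t} (\<lambda>s. superop_exp ?L (t - s) (M (dyson_term K M \<rho> l s)))" .
  \<comment> \<open>At time 0 every term of positive order is an integral over one point.\<close>
  moreover have "(\<Sum>k\<le>l. dyson_term K M \<rho> k 0) = \<rho>"
    by (subst sum.atMost_shift) (simp add: linear_0[OF linear_superop_exp[OF K]])
  ultimately show ?thesis
    by simp
qed

end

section \<open>Error propagation under recovery\<close>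

text \<open>The complex coefficient sits in the generators because \<open>span\<close> takes real
  combinations.\<close>

definition error_span ::
    "nat \<Rightarrow> (nat \<Rightarrow> 'n::finite operator) \<Rightarrow> 'n operator \<Rightarrow> nat \<Rightarrow> 'n operator set" where
  "error_span N E \<rho> k = span {c \<cdot>\<^sub>C (error_product E \<mu> ** \<rho> ** dagger (error_product E \<nu>)) | c \<mu> \<nu>.
     \<mu> \<in> error_seqs_upto N k \<and> \<nu> \<in> error_seqs_upto N k}"

lemma error_span_base:
  "\<mu> \<in> error_seqs_upto N k \<Longrightarrow> \<nu> \<in> error_seqs_upto N k \<Longrightarrow>
     c \<cdot>\<^sub>C (error_product E \<mu> ** \<rho> ** dagger (error_product E \<nu>)) \<in> error_span N E \<rho> k"
  unfolding error_span_def by (rule span_base) blast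

lemma subspace_error_span: "subspace (error_span N E \<rho> k)"
  by (simp add: error_span_def)

lemma error_span_induct:
  assumes X: "X \<in> error_span N E \<rho> k" and lin: "linear f" and V: "subspace V"
    and base: "\<And>c \<mu> \<nu>. \<mu> \<in> error_seqs_upto N k \<Longrightarrow> \<nu> \<in> error_seqs_upto N k \<Longrightarrow>
      f (c \<cdot>\<^sub>C (error_product E \<mu> ** \<rho> ** dagger (error_product E \<nu>))) \<in> V"
  shows "f X \<in> V"
proof -
  have "subspace (f -` V)"
    using lin V by (rule linear_subspace_vimage)
  then have "error_span N E \<rho> k \<subseteq> f -` V"
    unfolding error_span_def by (rule span_minimal[rotated]) (use base in auto)
  with X show ?thesis
    by blast
qed

lemma error_seqs_upto_mono: "j \<le> k \<Longrightarrow> error_seqs_upto N j \<subseteq> error_seqs_upto N k"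
  by (auto simp: error_seqs_upto_def)

lemma error_span_mono: "j \<le> k \<Longrightarrow> error_span N E \<rho> j \<subseteq> error_span N E \<rho> k"
  unfolding error_span_def using error_seqs_upto_mono[of j k N] by (intro span_mono) blast

text \<open>The jump part prepends one label on both sides, the anticommutator one on a single side.
  That \<open>dagger (E j) ** E j\<close> counts as an elementary error keeps the weight from
  growing by two.\<close>

lemma error_lindbladian_error_span:
  assumes "X \<in> error_span N E \<rho> k"
  shows "error_lindbladian N lam E X \<in> error_span N E \<rho> (Suc k)"
proof (rule error_span_induct[OF assms linear_error_lindbladian subspace_error_span])
  fix c \<mu> \<nu>
  assume \<mu>: "\<mu> \<in> error_seqs_upto N k" and \<nu>: "\<nu> \<in> error_seqs_upto N k"
  let ?K = "error_product E \<mu>" and ?K' = "error_product E \<nu>"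
  have up: "\<mu> \<in> error_seqs_upto N (Suc k)" "\<nu> \<in> error_seqs_upto N (Suc k)"
    using \<mu> \<nu> error_seqs_upto_mono[of k "Suc k"] by auto
  have cons: "x # \<xi> \<in> error_seqs_upto N (Suc k)"
    if "\<xi> \<in> error_seqs_upto N k" "x \<in> Jump ` {1..N} \<union> Decay ` {1..N}" for x \<xi>
    using that by (auto simp: error_seqs_upto_def error_seqs_def)
  have summand: "E j ** (c \<cdot>\<^sub>C (?K ** \<rho> ** dagger ?K')) ** dagger (E j)
      - (1/2) *\<^sub>R (dagger (E j) ** E j ** (c \<cdot>\<^sub>C (?K ** \<rho> ** dagger ?K'))
        + (c \<cdot>\<^sub>C (?K ** \<rho> ** dagger ?K')) ** (dagger (E j) ** E j)) \<in> error_span N E \<rho> (Suc k)"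
    if j: "j \<in> {1..N}" for j
  proof -
    have "E j ** (c \<cdot>\<^sub>C (?K ** \<rho> ** dagger ?K')) ** dagger (E j)
        = c \<cdot>\<^sub>C (error_product E (Jump j # \<mu>) ** \<rho> ** dagger (error_product E (Jump j # \<nu>)))"
      by (simp add: cscale_mult matrix_mul_assoc)
    moreover have "dagger (E j) ** E j ** (c \<cdot>\<^sub>C (?K ** \<rho> ** dagger ?K'))
        = c \<cdot>\<^sub>C (error_product E (Decay j # \<mu>) ** \<rho> ** dagger (error_product E \<nu>))"
      by (simp add: cscale_mult matrix_mul_assoc)
    moreover have "(c \<cdot>\<^sub>C (?K ** \<rho> ** dagger ?K')) ** (dagger (E j) ** E j)
        = c \<cdot>\<^sub>C (error_product E \<mu> ** \<rho> ** dagger (error_product E (Decay j # \<nu>)))"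
      by (simp add: cscale_mult matrix_mul_assoc)
    moreover have "Jump j # \<mu> \<in> error_seqs_upto N (Suc k)" "Jump j # \<nu> \<in> error_seqs_upto N (Suc k)"
      "Decay j # \<mu> \<in> error_seqs_upto N (Suc k)" "Decay j # \<nu> \<in> error_seqs_upto N (Suc k)"
      using cons \<mu> \<nu> j by auto
    ultimately show ?thesis
      using up by (simp only:) (intro subspace_diff[OF subspace_error_span]
        subspace_scale[OF subspace_error_span] subspace_add[OF subspace_error_span] error_span_base; assumption)
  qed
  show "error_lindbladian N lam E (c \<cdot>\<^sub>C (?K ** \<rho> ** dagger ?K')) \<in> error_span N E \<rho> (Suc k)"
    unfolding error_lindbladian_def
    by (intro subspace_sum[OF subspace_error_span] subspace_scale[OF subspace_error_span] summand)
qed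

lemma subspace_op_range: "vec.subspace S \<Longrightarrow> subspace {X :: 'n::finite operator. op_range X \<subseteq> S}"
  using vec_subspace_subspace[of S]
  by (auto simp: subspace_def op_range_def image_subset_iff matrix_vector_mult_add_rdistrib scaleR_vector)

lemma error_span_op_range:
  assumes C: "vec.subspace C" "op_range \<rho> \<subseteq> C" and X: "X \<in> error_span N E \<rho> l"
  shows "op_range X \<subseteq> correctable_space N E C l"
proof -
  have S: "vec.subspace (correctable_space N E C l)"
    by (simp add: correctable_space_def)
  have "X \<in> {X. op_range X \<subseteq> correctable_space N E C l}"
  proof (rule error_span_induct[OF X linear_id[unfolded id_def] subspace_op_range[OF S]])
    fix c \<mu> \<nu>
    assume "\<mu> \<in> error_seqs_upto N l"
    then have "error_product E \<mu> *v (\<rho> *v v) \<in> correctable_space N E C l" for v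
      using C(2) unfolding correctable_space_def op_range_def by (intro vec.span_base) blast
    then show "c \<cdot>\<^sub>C (error_product E \<mu> ** \<rho> ** dagger (error_product E \<nu>)) \<in>
        {X. op_range X \<subseteq> correctable_space N E C l}"
      using S by (auto simp: op_range_def cscale_vector vec.subspace_scale simp flip: matrix_vector_mul_assoc)
  qed
  then show ?thesis
    by simp
qed

lemma Nil_error_seqs_upto: "[] \<in> error_seqs_upto N k"
  by (simp add: error_seqs_upto_def error_seqs_def)

lemma code_subset_correctable_space: "C \<subseteq> correctable_space N E C l"
proof
  fix w assume "w \<in> C"
  then have "error_product E [] *v w \<in> correctable_space N E C l"
    unfolding correctable_space_def using Nil_error_seqs_upto by (intro vec.span_base) blast
  then show "w \<in> correctable_space N E C l"
    by simp
qed

section \<open>Codes with noise and recovery\<close>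

locale recovered_code =
  fixes C :: "(complex ^ 'n::finite) set" and E :: "nat \<Rightarrow> 'n operator" and lam :: "nat \<Rightarrow> real"
    and N l :: nat and LR :: "'n superoperator" and \<Delta> \<kappa> chi :: real
  assumes code: "vec.subspace C"
    and weights: "\<And>\<mu>. \<mu> \<in> {1..N} \<Longrightarrow> 0 \<le> lam \<mu>"
    and rate: "0 \<le> \<Delta>" and params: "0 < \<kappa>" "0 < chi"
    and lindbladian: "lindbladian LR"
    and convergence: "convergence_condition LR \<kappa> chi"
    and recovery: "recovery_condition LR N E C l"
    and reduction: "strict_error_reduction LR N E C"
begin

definition noise :: "'n superoperator" where
  "noise X = \<Delta> *\<^sub>R error_lindbladian N lam E X"

abbreviation recover :: "'n superoperator" where "recover \<equiv> superop_limit LR"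

abbreviation evolve :: "real \<Rightarrow> 'n superoperator" where
  "evolve \<equiv> superop_exp (\<lambda>X. LR X + noise X)"

definition nE :: real where
  "nE = restricted_norm (correctable_space N E C l) (error_lindbladian N lam E)"

lemma linear_LR: "linear LR"
  using lindbladian by (simp add: lindbladian_def clinear_linear)

lemma linear_noise: "linear noise"
  unfolding noise_def[abs_def] by (intro linear_compose_scale_right linear_error_lindbladian)

lemma exp_LR: "0 \<le> t \<Longrightarrow> positive_trace_preserving (superop_exp LR t)"
  using lindbladian by (simp add: lindbladian_def cptp_positive_trace_preserving)

lemma exp_LR_clinear: "0 \<le> t \<Longrightarrow> clinear_superop (superop_exp LR t)"
  using exp_LR by (simp add: positive_trace_preserving_def)

lemma recover: "positive_trace_preserving recover"
  by (intro superop_limit_positive_trace_preserving superop_limit_tendsto[OF _ convergence] exp_LR exp_LR_clinear)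

lemma linear_recover: "linear recover"
  using recover clinear_linear by (auto simp: positive_trace_preserving_def)

lemma dissipative_noise: "dissipative noise"
  unfolding noise_def[abs_def] by (intro dissipative_scaleR dissipative_error_lindbladian weights rate)

lemma hermitian_noise: "hermitian X \<Longrightarrow> hermitian (noise X)"
  using dissipative_noise by (simp add: dissipative_def)

lemma noise_error_span: "X \<in> error_span N E \<rho> k \<Longrightarrow> noise X \<in> error_span N E \<rho> (Suc k)"
  unfolding noise_def by (intro subspace_scale[OF subspace_error_span] error_lindbladian_error_span)

lemma linear_generator: "linear (\<lambda>X. LR X + noise X)"
  by (rule linear_compose_add[OF linear_LR linear_noise])

lemma dissipative_generator: "dissipative (\<lambda>X. LR X + noise X)"
  by (intro dissipative_add dissipative_noise dissipative_lindbladian[OF linear_LR] exp_LR)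

lemma hermitian_evolve: "hermitian X \<Longrightarrow> hermitian (evolve t X)"
  using hermitian_superop_exp[OF linear_generator] dissipative_generator by (auto simp: dissipative_def)

lemma nE_nonneg: "\<psi> \<in> C \<Longrightarrow> norm \<psi> = 1 \<Longrightarrow> 0 \<le> nE"
  unfolding nE_def using code_subset_correctable_space[of C N E l]
  by (intro restricted_norm_nonneg[OF linear_error_lindbladian]) (auto simp: correctable_space_def)

section \<open>Dyson terms of a pure code state\<close>

context
  fixes \<psi> :: "complex ^ 'n"
  assumes \<psi>: "\<psi> \<in> C" "norm \<psi> = 1"
begin

abbreviation V :: "nat \<Rightarrow> 'n operator set" where "V \<equiv> error_span N E (ketbra \<psi>)"

abbreviation D :: "nat \<Rightarrow> real \<Rightarrow> 'n operator" where "D \<equiv> dyson_term LR noise (ketbra \<psi>)"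

text \<open>Strict error reduction concerns single products; complex linearity and the scalars in
  the generators carry it to the span. It is available for forward times only, which is why the
  Dyson terms are used in convolution form from here on.\<close>

lemma exp_LR_error_span:
  assumes "0 \<le> t" "X \<in> V k"
  shows "superop_exp LR t X \<in> V k"
proof (rule error_span_induct[OF assms(2) linear_superop_exp[OF linear_LR] subspace_error_span])
  fix c \<mu> \<nu>
  assume \<mu>: "\<mu> \<in> error_seqs_upto N k" and \<nu>: "\<nu> \<in> error_seqs_upto N k"
  then obtain a where a: "superop_exp LR t (error_product E \<mu> ** ketbra \<psi> ** dagger (error_product E \<nu>)) =
      (\<Sum>\<mu>'\<in>error_seqs_upto N (length \<mu>). \<Sum>\<nu>'\<in>error_seqs_upto N (length \<nu>).
         a \<mu>' \<nu>' \<cdot>\<^sub>C (error_product E \<mu>' ** ketbra \<psi> ** dagger (error_product E \<nu>')))"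
    using reduction assms(1) ketbra_code_density[OF code \<psi>]
    unfolding strict_error_reduction_def error_seqs_upto_def by blast
  have "superop_exp LR t (c \<cdot>\<^sub>C (error_product E \<mu> ** ketbra \<psi> ** dagger (error_product E \<nu>))) =
      c \<cdot>\<^sub>C superop_exp LR t (error_product E \<mu> ** ketbra \<psi> ** dagger (error_product E \<nu>))"
    using exp_LR_clinear[OF assms(1)] by (simp add: clinear_superop_def)
  also have "\<dots> = (\<Sum>\<mu>'\<in>error_seqs_upto N (length \<mu>). \<Sum>\<nu>'\<in>error_seqs_upto N (length \<nu>).
         (c * a \<mu>' \<nu>') \<cdot>\<^sub>C (error_product E \<mu>' ** ketbra \<psi> ** dagger (error_product E \<nu>')))"
    by (simp add: a linear_sum[OF linear_cscale] cscale_simps(3))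
  also have "\<dots> \<in> V k"
  proof (intro subspace_sum[OF subspace_error_span] error_span_base)
    have "length \<mu> \<le> k" "length \<nu> \<le> k"
      using \<mu> \<nu> by (auto simp: error_seqs_upto_def)
    then show "\<mu>' \<in> error_seqs_upto N k" if "\<mu>' \<in> error_seqs_upto N (length \<mu>)" for \<mu>'
      using that error_seqs_upto_mono by blast
    show "\<nu>' \<in> error_seqs_upto N k" if "\<nu>' \<in> error_seqs_upto N (length \<nu>)" for \<nu>'
      using that \<open>length \<nu> \<le> k\<close> error_seqs_upto_mono by blast
  qed
  finally show "superop_exp LR t (c \<cdot>\<^sub>C (error_product E \<mu> ** ketbra \<psi> ** dagger (error_product E \<nu>))) \<in> V k" .
qed

text \<open>The recovery condition leaves the factor of proportionality open; trace preservation
  identifies it as the trace. Hence traceless members of the span are annihilated.\<close>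

lemma recover_error_span:
  assumes "X \<in> V l"
  shows "recover X = trace X \<cdot>\<^sub>C ketbra \<psi>"
proof -
  have lin: "linear (\<lambda>X. recover X - trace X \<cdot>\<^sub>C ketbra \<psi>)"
  proof (intro linear_compose_sub linear_recover)
    show "linear (\<lambda>X. trace X \<cdot>\<^sub>C ketbra \<psi>)"
      by (rule linearI)
         (simp_all add: trace_add cscale_simps trace_scaleR, simp add: vec_eq_iff cscale_def)
  qed
  have "recover X - trace X \<cdot>\<^sub>C ketbra \<psi> \<in> {0}"
  proof (rule error_span_induct[OF assms lin])
    fix c \<mu> \<nu>
    assume "\<mu> \<in> error_seqs_upto N l" "\<nu> \<in> error_seqs_upto N l"
    then obtain b where b: "recover (error_product E \<mu> ** ketbra \<psi> ** dagger (error_product E \<nu>)) = b \<cdot>\<^sub>C ketbra \<psi>"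
      using recovery ketbra_code_density[OF code \<psi>] unfolding recovery_condition_def by blast
    let ?X = "c \<cdot>\<^sub>C (error_product E \<mu> ** ketbra \<psi> ** dagger (error_product E \<nu>))"
    have RX: "recover ?X = (c * b) \<cdot>\<^sub>C ketbra \<psi>"
      using recover by (simp add: positive_trace_preserving_def clinear_superop_def b cscale_simps)
    have "trace ?X = trace (recover ?X)"
      using recover by (simp add: positive_trace_preserving_def)
    also have "\<dots> = c * b"
      using \<psi> by (simp add: RX trace_cscale trace_ketbra)
    finally show "recover ?X - trace ?X \<cdot>\<^sub>C ketbra \<psi> \<in> {0}"
      by (simp add: RX)
  qed (rule subspace_single_0)
  then show ?thesis
    by simp
qed

lemma ketbra_error_span: "ketbra \<psi> \<in> V k"
  using error_span_base[OF Nil_error_seqs_upto Nil_error_seqs_upto, of 1 E "ketbra \<psi>" N k]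
  by (simp add: cscale_simps)

lemma dyson_error_span: "0 \<le> t \<Longrightarrow> D k t \<in> V k"
proof (induction k arbitrary: t)
  case 0
  then show ?case
    by (simp add: exp_LR_error_span ketbra_error_span)
next
  case (Suc k)
  have "noise (D k s) \<in> V (Suc k)" if "0 \<le> s" for s
    by (intro noise_error_span Suc.IH that)
  then show ?case
    unfolding dyson_term_integral[OF linear_LR linear_noise Suc.prems]
    by (intro integral_in_subspace[OF subspace_error_span] exp_LR_error_span integrable_continuous_real
        superop_exp_continuous_on[OF linear_LR] continuous_intros
        linear_continuous_on_compose[OF dyson_term_continuous[OF linear_LR linear_noise] linear_noise]) auto
qed

lemma dyson_hermitian: "0 \<le> t \<Longrightarrow> hermitian (D k t)"
proof (induction k arbitrary: t)
  case 0
  then show ?case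
    by (simp add: positive_hermitian_contraction(1)[OF exp_LR] hermitian_ketbra)
next
  case (Suc k)
  have "D (Suc k) t \<in> {X. hermitian X}"
    unfolding dyson_term_integral[OF linear_LR linear_noise Suc.prems]
    using Suc.IH
    by (intro integral_in_subspace[OF subspace_hermitian] integrable_continuous_real
        superop_exp_continuous_on[OF linear_LR] continuous_intros
        linear_continuous_on_compose[OF dyson_term_continuous[OF linear_LR linear_noise] linear_noise])
       (auto intro!: positive_hermitian_contraction(1)[OF exp_LR] hermitian_noise)
  then show ?case
    by simp
qed

lemma trace_noise: "trace (noise X) = 0"
  by (simp add: noise_def trace_scaleR trace_error_lindbladian)

lemma dyson_trace:
  assumes "0 \<le> t"
  shows "trace (D (Suc k) t) = 0"
proof -
  have "D (Suc k) t \<in> {X. trace X = 0}"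
    unfolding dyson_term_integral[OF linear_LR linear_noise assms]
  proof (intro integral_in_subspace integrable_continuous_real
        superop_exp_continuous_on[OF linear_LR] continuous_intros
        linear_continuous_on_compose[OF dyson_term_continuous[OF linear_LR linear_noise] linear_noise])
    show "subspace {X :: 'n operator. trace X = 0}"
      by (rule linear_subspace_kernel[OF linear_trace])
    show "superop_exp LR (t - s) (noise (D k s)) \<in> {X. trace X = 0}" if "s \<in> {0..t}" for s
      using exp_LR[of "t - s"] that by (simp add: positive_trace_preserving_def trace_noise)
  qed
  then show ?thesis
    by simp
qed

lemma noise_bound:
  assumes "hermitian X" "X \<in> V l"
  shows "trace_norm (noise X) \<le> \<Delta> * nE * trace_norm X"
proof -
  have herm: "hermitian (error_lindbladian N lam E X)"
    using dissipative_error_lindbladian[where lam = lam and N = N and E = E, OF weights] assms(1) by (simp add: dissipative_def)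
  have "op_range X \<subseteq> correctable_space N E C l"
    by (rule error_span_op_range[OF code op_range_ketbra[OF code \<psi>(1)] assms(2)])
  then have "trace_norm (error_lindbladian N lam E X) \<le> nE * trace_norm X"
    unfolding nE_def using assms(1)
    by (intro restricted_norm_bound[OF linear_error_lindbladian]) (simp_all add: correctable_space_def)
  then have "\<Delta> * trace_norm (error_lindbladian N lam E X) \<le> \<Delta> * (nE * trace_norm X)"
    using rate by (rule mult_left_mono)
  then show ?thesis
    using trace_norm_scaleR_le[OF herm rate] by (simp add: noise_def mult.assoc)
qed

lemma dyson_bound: "k \<le> l \<Longrightarrow> 0 \<le> t \<Longrightarrow>
    trace_norm (D k t) \<le> (chi * \<Delta> * nE / \<kappa>) ^ k * poisson_tail k (\<kappa> * t)"
proof (induction k arbitrary: t)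
  case 0
  have "trace_norm (D 0 t) \<le> trace_norm (ketbra \<psi>)"
    using positive_hermitian_contraction(2)[OF exp_LR[OF 0(2)] hermitian_ketbra] by simp
  also have "\<dots> \<le> 1"
    using psd_trace_norm[OF psd_ketbra, of \<psi>] \<psi> by (simp add: trace_ketbra)
  finally show ?case
    by (simp add: poisson_tail_def)
next
  case (Suc k)
  let ?b = "(chi * \<Delta> * nE / \<kappa>) ^ k"
  \<comment> \<open>Each order costs \<open>chi\<close> for the damping,
    \<open>\<Delta> * nE\<close> for the noise, and \<open>1 / \<kappa>\<close> to compensate the
    normalisation of the exponential density.\<close>
  let ?g = "\<lambda>s. (chi * \<Delta> * nE / \<kappa>) ^ Suc k * (\<kappa> * exp (- \<kappa> * (t - s)) * poisson_tail k (\<kappa> * s))"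
  have "trace_norm (D (Suc k) t) \<le> integral {0..t} ?g"
    unfolding dyson_term_integral[OF linear_LR linear_noise Suc.prems(2)]
  proof (rule trace_norm_integral_le)
    show "continuous_on {0..t} (\<lambda>s. superop_exp LR (t - s) (noise (D k s)))"
      by (intro superop_exp_continuous_on[OF linear_LR] continuous_intros
        linear_continuous_on_compose[OF dyson_term_continuous[OF linear_LR linear_noise] linear_noise])
    show "continuous_on {0..t} ?g"
      by (intro continuous_intros continuous_on_compose2[OF poisson_tail_continuous[of UNIV]]) auto
    fix s assume s: "s \<in> {0..t}"
    define Y where "Y = noise (D k s)"
    have DV: "D k s \<in> V k"
      using s by (intro dyson_error_span) simp
    have D_herm: "hermitian (D k s)"
      using s by (intro dyson_hermitian) simp
    then have Y_herm: "hermitian Y"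
      by (simp add: Y_def hermitian_noise)
    then show "hermitian (superop_exp LR (t - s) (noise (D k s)))"
      using s by (simp add: Y_def positive_hermitian_contraction(1)[OF exp_LR])
    have "Y \<in> V (Suc k)"
      unfolding Y_def by (rule noise_error_span[OF DV])
    \<comment> \<open>This is where \<open>Suc k \<le> l\<close> enters: after one more noise factor
      the operator must still be one that the recovery handles.\<close>
    then have "Y \<in> V l"
      using error_span_mono[OF Suc.prems(1)] by blast
    then have "recover Y = 0"
      by (simp add: recover_error_span Y_def trace_noise cscale_simps)
    then have "trace_norm (superop_exp LR (t - s) Y) \<le> chi * exp (- \<kappa> * (t - s)) * trace_norm Y"
      using s by (intro superop_exp_decay[OF exp_LR linear_LR convergence Y_herm]) auto
    also have "\<dots> \<le> chi * exp (- \<kappa> * (t - s)) * (\<Delta> * nE * (?b * poisson_tail k (\<kappa> * s)))"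
    proof (rule mult_left_mono)
      have "D k s \<in> V l"
        using DV error_span_mono[of k l] Suc.prems(1) by auto
      then have "trace_norm Y \<le> \<Delta> * nE * trace_norm (D k s)"
        unfolding Y_def by (rule noise_bound[OF D_herm])
      also have "\<dots> \<le> \<Delta> * nE * (?b * poisson_tail k (\<kappa> * s))"
        using Suc s rate nE_nonneg[OF \<psi>] by (intro mult_left_mono) auto
      finally show "trace_norm Y \<le> \<Delta> * nE * (?b * poisson_tail k (\<kappa> * s))" .
    qed (use params in simp)
    also have "\<dots> = ?g s"
      using params by simp
    finally show "trace_norm (superop_exp LR (t - s) (noise (D k s))) \<le> ?g s"
      by (simp add: Y_def)
  qed
  also have "\<dots> = (chi * \<Delta> * nE / \<kappa>) ^ Suc k * poisson_tail (Suc k) (\<kappa> * t)"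
    using integral_exp_poisson_tail[OF params(1) Suc.prems(2), of k] by (simp only: integral_mult_right)
  finally show ?case .
qed

text \<open>\<open>X\<close> is the remainder integral. The recovery returns the Dyson sum exactly
  to the initial state, so the whole logical error sits in \<open>recover X\<close>.\<close>

lemma recovered_evolution:
  assumes t: "0 \<le> t"
  obtains X where "hermitian X" "recover (evolve t (ketbra \<psi>)) = ketbra \<psi> + recover X"
    "trace_norm X \<le> 1 / (chi + 1) * ((chi + 1) * \<Delta> * nE / \<kappa>) ^ (l + 1) * F_fun l (\<kappa> * t)"
proof -
  let ?f = "\<lambda>s. evolve (t - s) (noise (D l s))"
  let ?b = "\<Delta> * nE * (chi * \<Delta> * nE / \<kappa>) ^ l"
  define X where "X = integral {0..t} ?f"
  have cont: "continuous_on {0..t} ?f"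
    by (intro superop_exp_continuous_on[OF linear_generator] continuous_intros
        linear_continuous_on_compose[OF dyson_term_continuous[OF linear_LR linear_noise] linear_noise])
  have herm: "hermitian (?f s)" if "s \<in> {0..t}" for s
    using that by (intro hermitian_evolve hermitian_noise dyson_hermitian) simp
  have X_herm: "hermitian X"
    using integral_in_subspace[OF subspace_hermitian integrable_continuous_real[OF cont]] herm
    by (simp add: X_def)
  have "trace_norm X \<le> integral {0..t} (\<lambda>s. ?b * poisson_tail l (\<kappa> * s))"
    unfolding X_def
  proof (rule trace_norm_integral_le[OF cont _ herm])
    show "continuous_on {0..t} (\<lambda>s. ?b * poisson_tail l (\<kappa> * s))"
      by (intro continuous_intros continuous_on_compose2[OF poisson_tail_continuous[of UNIV]]) auto
    fix s assume s: "s \<in> {0..t}"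
    have D_herm: "hermitian (D l s)"
      using s by (intro dyson_hermitian) simp
    \<comment> \<open>After this last noise factor the operator may have left the correctable space,
      so only contraction of the full evolution is used and no factor \<open>chi\<close>
      appears.\<close>
    have "trace_norm (?f s) \<le> trace_norm (noise (D l s))"
      using s by (intro dissipative_contraction[OF linear_generator dissipative_generator]
          hermitian_noise D_herm) simp
    also have "\<dots> \<le> \<Delta> * nE * trace_norm (D l s)"
      using s by (intro noise_bound D_herm dyson_error_span) simp
    also have "\<dots> \<le> \<Delta> * nE * ((chi * \<Delta> * nE / \<kappa>) ^ l * poisson_tail l (\<kappa> * s))"
      using dyson_bound[of l s] s rate nE_nonneg[OF \<psi>] by (intro mult_left_mono) auto
    finally show "trace_norm (?f s) \<le> ?b * poisson_tail l (\<kappa> * s)"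
      by (simp add: mult.assoc)
  qed
  also have "\<dots> = ?b * (F_fun l (\<kappa> * t) / \<kappa>)"
    using integral_poisson_tail[OF params(1) t, of l] by (simp only: integral_mult_right)
  \<comment> \<open>Enlarging \<open>chi\<close> to \<open>chi + 1\<close> in the \<open>l\<close>
    damped factors; the undamped factor then supplies the prefactor
    \<open>1 / (chi + 1)\<close>.\<close>
  also have "\<dots> \<le> (\<Delta> * nE * ((chi + 1) * \<Delta> * nE / \<kappa>) ^ l) * (F_fun l (\<kappa> * t) / \<kappa>)"
    using rate nE_nonneg[OF \<psi>] params F_fun_nonneg[of "\<kappa> * t" l] t
    by (intro mult_right_mono mult_left_mono power_mono divide_right_mono) auto
  also have "\<dots> = (\<Delta> * nE / \<kappa>) * ((chi + 1) * \<Delta> * nE / \<kappa>) ^ l * F_fun l (\<kappa> * t)"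
    by simp
  also have "\<Delta> * nE / \<kappa> = 1 / (chi + 1) * ((chi + 1) * \<Delta> * nE / \<kappa>)"
    using params by simp
  also have "1 / (chi + 1) * ((chi + 1) * \<Delta> * nE / \<kappa>) * ((chi + 1) * \<Delta> * nE / \<kappa>) ^ l * F_fun l (\<kappa> * t)
      = 1 / (chi + 1) * ((chi + 1) * \<Delta> * nE / \<kappa>) ^ (l + 1) * F_fun l (\<kappa> * t)"
    by (simp only: Suc_eq_plus1[symmetric] power_Suc mult.assoc)
  finally have bound: "trace_norm X \<le>
      1 / (chi + 1) * ((chi + 1) * \<Delta> * nE / \<kappa>) ^ (l + 1) * F_fun l (\<kappa> * t)" .
  have "recover (D 0 t) = ketbra \<psi>"
  proof -
    have "trace (D 0 t) = 1"
      using exp_LR[OF t] \<psi> by (simp add: positive_trace_preserving_def trace_ketbra)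
    moreover have "D 0 t \<in> V l"
      using dyson_error_span[OF t, of 0] error_span_mono[of 0 l] by blast
    ultimately show ?thesis
      by (simp add: recover_error_span cscale_simps del: dyson_term.simps)
  qed
  moreover have "recover (D (Suc k) t) = 0" if "k < l" for k
  proof -
    have "D (Suc k) t \<in> V l"
      using dyson_error_span[OF t, of "Suc k"] error_span_mono[of "Suc k" l] that by auto
    then show ?thesis
      by (simp add: recover_error_span dyson_trace[OF t] cscale_simps del: dyson_term.simps)
  qed
  ultimately have "recover (\<Sum>k\<le>l. D k t) = ketbra \<psi>"
    unfolding sum.atMost_shift linear_add[OF linear_recover] linear_sum[OF linear_recover]
    by (simp del: dyson_term.simps)
  then have "recover (evolve t (ketbra \<psi>)) = ketbra \<psi> + recover X"
    unfolding dyson_remainder[OF linear_LR linear_noise t, of _ l] X_def linear_add[OF linear_recover] by simp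
  with X_herm bound that show thesis
    by blast
qed

end

section \<open>The two logical error measures\<close>

lemma logical_infidelity_le:
  assumes t: "0 \<le> t" and ne: "\<exists>\<psi>\<in>C. norm \<psi> = 1"
  shows "logical_infidelity C LR (\<lambda>X. LR X + noise X) t \<le>
    1 / (chi + 1) * ((chi + 1) * \<Delta> * nE / \<kappa>) ^ (l + 1) * F_fun l (\<kappa> * t)" (is "_ \<le> ?B")
proof -
  have "1 - ?B \<le> (INF \<psi>\<in>{\<psi> \<in> C. norm \<psi> = 1}.
      Re (trace (ketbra \<psi> ** recover (evolve t (ketbra \<psi>)))))"
  proof (rule cINF_greatest)
    show "{\<psi> \<in> C. norm \<psi> = 1} \<noteq> {}"
      using ne by auto
    fix \<psi> assume "\<psi> \<in> {\<psi> \<in> C. norm \<psi> = 1}"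
    then have \<psi>: "\<psi> \<in> C" "norm \<psi> = 1"
      by auto
    obtain X where X: "hermitian X" "recover (evolve t (ketbra \<psi>)) = ketbra \<psi> + recover X"
      "trace_norm X \<le> ?B"
      using recovered_evolution[OF \<psi> t] .
    have "\<bar>Re (cinner \<psi> (recover X *v \<psi>))\<bar> \<le> trace_norm (recover X)"
      by (rule form_le_trace_norm[OF positive_hermitian_contraction(1)[OF recover X(1)] \<psi>(2)])
    also have "\<dots> \<le> trace_norm X"
      by (rule positive_hermitian_contraction(2)[OF recover X(1)])
    finally show "1 - ?B \<le> Re (trace (ketbra \<psi> ** recover (evolve t (ketbra \<psi>))))"
      using X(3) \<psi> by (simp add: X(2) trace_ketbra_mult matrix_vector_mult_add_rdistrib cinner_add_right
          ketbra_form cinner_self)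
  qed
  then show ?thesis
    by (simp add: logical_infidelity_def)
qed

text \<open>No recovery occurs in this measure, but \<open>recover\<close> is a contraction, so the
  distance after recovery is a lower bound. There the ideal states contribute 2 to the test with
  \<open>ketbra u - ketbra v\<close>, and the two remainders take away at most \<open>2 * B\<close>;
  halving gives \<open>1 - B\<close>.\<close>

lemma logical_indistinguishability_le:
  assumes t: "0 \<le> t"
    and ne: "\<exists>\<psi>0\<in>C. \<exists>\<psi>1\<in>C. norm \<psi>0 = 1 \<and> norm \<psi>1 = 1 \<and> cinner \<psi>0 \<psi>1 = 0"
  shows "logical_indistinguishability C (\<lambda>X. LR X + noise X) t \<le>
    1 / (chi + 1) * ((chi + 1) * \<Delta> * nE / \<kappa>) ^ (l + 1) * F_fun l (\<kappa> * t)" (is "_ \<le> ?B")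
proof -
  define S where "S = {(\<psi>0, \<psi>1). \<psi>0 \<in> C \<and> \<psi>1 \<in> C \<and> norm \<psi>0 = 1 \<and> norm \<psi>1 = 1 \<and> cinner \<psi>0 \<psi>1 = 0}"
  define B where "B = ?B"
  have "1 - B \<le> (INF (\<psi>0, \<psi>1)\<in>S. 1/2 * trace_norm (evolve t (ketbra \<psi>0) - evolve t (ketbra \<psi>1)))"
  proof (rule cINF_greatest)
    show "S \<noteq> {}"
      using ne by (auto simp: S_def)
    fix p assume "p \<in> S"
    then obtain u v where p: "p = (u, v)" and u: "u \<in> C" "norm u = 1" and v: "v \<in> C" "norm v = 1"
      and orth: "cinner u v = 0"
      by (auto simp: S_def)
    obtain X where X: "hermitian X" "recover (evolve t (ketbra u)) = ketbra u + recover X"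
      "trace_norm X \<le> B"
      using recovered_evolution[OF u t] unfolding B_def by blast
    obtain Y where Y: "hermitian Y" "recover (evolve t (ketbra v)) = ketbra v + recover Y"
      "trace_norm Y \<le> B"
      using recovered_evolution[OF v t] unfolding B_def by blast
    let ?Z = "evolve t (ketbra u) - evolve t (ketbra v)"
    have Z: "hermitian ?Z"
      by (simp add: hermitian_evolve hermitian_ketbra)
    have herm: "hermitian (recover X)" "hermitian (recover Y)"
      using positive_hermitian_contraction(1)[OF recover] X Y by blast+
    have vu: "cinner v u = 0"
      using orth cnj_cinner[of u v] by simp
    have RZ: "recover ?Z = (ketbra u + recover X) - (ketbra v + recover Y)"
      by (simp add: linear_diff[OF linear_recover] X Y)
    have "2 + (Re (cinner u ((recover X - recover Y) *v u)) - Re (cinner v ((recover X - recover Y) *v v)))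
        = Re (cinner u (recover ?Z *v u)) - Re (cinner v (recover ?Z *v v))"
      unfolding RZ using u v
      by (simp add: matrix_vector_mult_add_rdistrib matrix_vector_mult_diff_rdistrib
          cinner_add_right cinner_diff_right ketbra_form cinner_self orth vu)
    also have "\<dots> \<le> trace_norm (recover ?Z)"
      by (rule orthogonal_forms_le_trace_norm[OF positive_hermitian_contraction(1)[OF recover Z] u(2) v(2) orth])
    also have "\<dots> \<le> trace_norm ?Z"
      by (rule positive_hermitian_contraction(2)[OF recover Z])
    finally have 1: "2 + (Re (cinner u ((recover X - recover Y) *v u))
        - Re (cinner v ((recover X - recover Y) *v v))) \<le> trace_norm ?Z" .
    \<comment> \<open>The same test with \<open>u\<close> and \<open>v\<close> exchanged bounds the
      perturbation in the preceding fact from below.\<close>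
    have "Re (cinner v ((recover X - recover Y) *v v)) - Re (cinner u ((recover X - recover Y) *v u))
        \<le> trace_norm (recover X - recover Y)"
      using orthogonal_forms_le_trace_norm[of "recover X - recover Y" v u] herm u v vu by simp
    also have "\<dots> \<le> trace_norm (recover X) + trace_norm (recover Y)"
      using trace_norm_triangle[of "recover X" "- recover Y"] herm trace_norm_minus[of "recover Y"]
        dagger_simps(3)[of 0 "recover Y"] by simp
    also have "\<dots> \<le> B + B"
      using positive_hermitian_contraction(2)[OF recover X(1)] positive_hermitian_contraction(2)[OF recover Y(1)]
        X(3) Y(3) by (intro add_mono) linarith+
    finally show "1 - B \<le> (case p of (\<psi>0, \<psi>1) \<Rightarrow> 1/2 * trace_norm (evolve t (ketbra \<psi>0) - evolve t (ketbra \<psi>1)))"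
      using 1 by (simp add: p)
  qed
  then show ?thesis
    by (simp add: logical_indistinguishability_def B_def flip: S_def)
qed

end

text \<open>Gram-Schmidt on two basis vectors; if the orthogonalised vector vanished,
  \<open>b\<close> would lie in the span of the rest of the basis.\<close>

lemma orthonormal_pair_exists:
  fixes C :: "(complex ^ 'n::finite) set"
  assumes C: "vec.subspace C" and dim: "2 \<le> vec.dim C"
  shows "\<exists>u\<in>C. \<exists>v\<in>C. norm u = 1 \<and> norm v = 1 \<and> cinner u v = 0"
proof -
  obtain B where B: "B \<subseteq> C" "vec.independent B" "card B = vec.dim C"
    using vec.basis_exists[of C] by metis
  then obtain a b where ab: "a \<in> B" "b \<in> B" "a \<noteq> b"
    using dim by (metis card_2_iff' obtain_subset_with_card_n insertI1 insertI2 subsetD card_2_iff)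
  have "a \<noteq> 0"
    using ab B(2) vec.dependent_zero by blast
  define w where "w = b - (cinner a b / cinner a a) *s a"
  have aw: "cinner a w = 0"
    using \<open>a \<noteq> 0\<close> by (simp add: w_def cinner_diff_right cinner_scale_right cinner_self)
  have "w \<noteq> 0"
  proof
    assume "w = 0"
    then have "b \<in> vec.span {a}"
      by (auto simp: w_def vec.span_singleton)
    then have "b \<in> vec.span (B - {b})"
      using ab vec.span_mono[of "{a}" "B - {b}"] by auto
    then show False
      using B(2) ab vec.dependent_def by blast
  qed
  have "w \<in> C"
    using C B ab by (auto simp: w_def intro!: vec.subspace_diff vec.subspace_scale)
  have "complex_of_real (1 / norm a) *s a \<in> C" "complex_of_real (1 / norm w) *s w \<in> C"
    using C B ab \<open>w \<in> C\<close> by (auto intro!: vec.subspace_scale)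
  moreover have "norm (complex_of_real (1 / norm a) *s a) = 1" "norm (complex_of_real (1 / norm w) *s w) = 1"
    using \<open>a \<noteq> 0\<close> \<open>w \<noteq> 0\<close> by (simp_all add: norm_vector_scale norm_divide)
  moreover have "cinner (complex_of_real (1 / norm a) *s a) (complex_of_real (1 / norm w) *s w) = 0"
    by (simp add: cinner_scale_left cinner_scale_right aw)
  ultimately show ?thesis
    by blast
qed

theorem theorem1:
  fixes C :: "(complex ^ 'n) set" and P :: "'n::finite operator"
    and E :: "nat \<Rightarrow> 'n::finite operator" and lam :: "nat \<Rightarrow> real" and N q l :: nat
    and LR LE L :: "'n::finite superoperator"
    and \<Delta> \<kappa> chi \<eta> nE :: real
  assumes code: "vec.subspace C" "vec.dim C = q" "q \<ge> 2"
    and projector: "orthogonal_projector C P"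
    and weights: "\<And>\<mu>. \<mu> \<in> {1..N} \<Longrightarrow> lam \<mu> > 0" "(\<Sum>\<mu>=1..N. lam \<mu>) = real N"
    and noise: "LE = error_lindbladian N lam E"
    and radius: "has_error_radius N E P l"
    and rate: "\<Delta> > 0"
    and recovery_lindbladian: "lindbladian LR"
    and params: "\<kappa> > 0" "chi > 0"
    and convergence: "convergence_condition LR \<kappa> chi"
    and recovery: "recovery_condition LR N E C l"
    and reduction: "strict_error_reduction LR N E C"
    and total: "L = (\<lambda>\<rho>. LR \<rho> + \<Delta> *\<^sub>R LE \<rho>)"
    and nE: "nE = restricted_norm (correctable_space N E C l) LE"
    and eta: "\<eta> = (chi + 1) * \<Delta> * nE / \<kappa>"
  shows "(\<forall>t\<ge>0. \<forall>X\<in>{logical_infidelity C LR L t, logical_indistinguishability C L t}.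
            X \<le> 1 / (chi + 1) * ((chi + 1) * \<Delta> * nE / \<kappa>) ^ (l + 1) * F_fun l (\<kappa> * t)
          \<and> 1 / (chi + 1) * ((chi + 1) * \<Delta> * nE / \<kappa>) ^ (l + 1) * F_fun l (\<kappa> * t)
              \<le> 1 / (chi + 1) * ((chi + 1) * \<Delta> * nE / \<kappa>) ^ (l + 1) * (\<kappa> * t)
          \<and> 1 / (chi + 1) * ((chi + 1) * \<Delta> * nE / \<kappa>) ^ (l + 1) * (\<kappa> * t)
              = 1 / (chi + 1) * \<eta> ^ (l + 1) * (\<kappa> * t))
       \<and> (\<forall>z\<ge>0. F_fun l z \<le> z)"
proof -
  interpret rc: recovered_code C E lam N l LR \<Delta> \<kappa> chi
    by unfold_locales (use assms in \<open>auto intro: less_imp_le\<close>)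
  have L: "L = (\<lambda>X. LR X + rc.noise X)"
    by (simp add: total noise rc.noise_def fun_eq_iff)
  have nE_eq: "nE = rc.nE"
    by (simp add: nE noise rc.nE_def)
  \<comment> \<open>The pair makes both infima range over nonempty sets, and its unit vectors show
    that the restricted norm is nonnegative.\<close>
  have pair: "\<exists>u\<in>C. \<exists>v\<in>C. norm u = 1 \<and> norm v = 1 \<and> cinner u v = 0"
    using orthonormal_pair_exists[OF code(1)] code by simp
  then have "0 \<le> nE"
    using rc.nE_nonneg by (auto simp: nE_eq)
  show ?thesis
  proof (intro conjI allI impI ballI)
    fix t X :: real
    assume t: "0 \<le> t" and "X \<in> {logical_infidelity C LR L t, logical_indistinguishability C L t}"
    then show "X \<le> 1 / (chi + 1) * ((chi + 1) * \<Delta> * nE / \<kappa>) ^ (l + 1) * F_fun l (\<kappa> * t)"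
      using rc.logical_infidelity_le[OF t] rc.logical_indistinguishability_le[OF t pair] pair
      unfolding L nE_eq by blast
    show "1 / (chi + 1) * ((chi + 1) * \<Delta> * nE / \<kappa>) ^ (l + 1) * F_fun l (\<kappa> * t)
        \<le> 1 / (chi + 1) * ((chi + 1) * \<Delta> * nE / \<kappa>) ^ (l + 1) * (\<kappa> * t)"
      using t params rate \<open>0 \<le> nE\<close> by (intro mult_left_mono F_fun_le) auto
  qed (simp_all add: eta F_fun_le)
qed

end
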